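(* Let $s\ge 1$ and let an $s$-stage Runge--Kutta method with real coefficients $(a_{ij})_{i,j=1}^s$, $(b_i)_{i=1}^s$, $c_i=\sum_{j=1}^s a_{ij}$, $\sum_{i=1}^s b_i=1$, be algebraically stable, i.e. $b_i\ge 0$ for $i=1,\dots,s$ and the symmetric matrix $M=(M_{ij})_{i,j=1}^s$ with $M_{ij}=b_ia_{ij}+b_ja_{ji}-b_ib_j$ is positive semi-definite. Consider the $s$-stage LEQRK-DG scheme with these coefficients: for given $u_h^n, U_h^n\in V_h$ (with $q_h^n=L_hu_h^n$) and given $u_{ih}^{n,*}\in V_h$, $i=1,\dots,s$, find $(u_h^{n+1},q_h^{n+1},U_h^{n+1})$ by $$u_h^{n+1}=u_h^n+\tau\sum_{i=1}^s b_i\xi_{ih},\qquad q_h^{n+1}=L_hu_h^{n+1},\qquad U^{n+1}=U_h^n+\tau\sum_{i=1}^s b_i l_i,\qquad U_h^{n+1}=\Pi U^{n+1},$$ where $\xi_{ih}\in V_h$, $\tilde q_{ih}\in V_h$ and the functions $l_i$ ($i=1,\dots,s$) are determined by $$(\xi_{ih},\phi)=-G(\tilde q_{ih},\phi)-\big(H(u_{ih}^{n,*})\tilde U_i,\phi\big),\qquad (\tilde q_{ih},\psi)=G(\tilde u_{ih},\psi)\qquad \forall\,\phi,\psi\in V_h,$$ $$l_i=\tfrac12 H(u_{ih}^{n,*})\,\xi_{ih},\qquad \tilde u_{ih}=u_h^n+\tau\sum_{j=1}^s a_{ij}\xi_{jh},\qquad \tilde U_i=U_h^n+\tau\sum_{j=1}^s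 a_{ij}l_j .$$ Then for every time step $\tau>0$ the scheme is uniquely solvable (for any such given data it determines exactly one $(u_h^{n+1},q_h^{n+1},U_h^{n+1})$), and it is unconditionally energy stable in the sense that $$E_h^{n+1}\le E_h^n-\tau\sum_{i=1}^s b_i\|\xi_{ih}\|^2,$$ where $E_h^n:=\frac12\|q_h^n\|^2+\|U_h^n\|^2$.
   Context: The scheme approximates the fourth order gradient flow $u_t=-\mathcal L^2u-\Phi'(u)$ on a convex domain $\Omega\subset\mathbb R^d$, where $\mathcal L=-(\Delta+a)$, $a\in\mathbb R$ is a parameter, and $\Phi:\mathbb R\to\mathbb R$ is a continuously differentiable nonlinear function bounded from below. The boundary conditions are either (i) $u$ is periodic, or (ii) $\partial_{\mathbf n}u=\partial_{\mathbf n}\Delta u=0$ on $\partial\Omega$, with $\mathbf n$ the unit outward normal. Mesh and space. $\Omega$ is a union of shape-regular (finitely many) mesh elements $\mathcal T_h=\{K\}$; $\Gamma^0$ is the set of interior interfaces and $\Gamma^\partial$ the set of boundary faces. The discontinuous Galerkin space is $V_h=\{v\in L^2(\Omega): v|_K\in P^k(K)\ \forall K\in\mathcal T_h\}$, with $P^k(K)$ the polynomials of degree at most $k$ on $K$. $(\cdot,\cdot)$ and $\|\cdot\|$ are the $L^2(\Omega)$ inner product and norm, and $\Pi:L^2(\Omega)\to V_h$ is the (piecewise) $L^2$ projection. On an interface $e\subset\partial K_1\cap\partial K_2$ with unit normal $\nu$ oriented from $K_1$ to $K_2$, set $\{v\}=\frac12(v|_{\partial K_1}+v|_{\partial K_2})$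 and $[v]=v|_{\partial K_2}-v|_{\partial K_1}$ (traces from the respective elements); $\partial_\nu$ is the derivative in direction $\nu$. Bilinear form. For $w,v\in V_h$, $$G(w,v)=\sum_{K\in\mathcal T_h}\int_K(\nabla w\cdot\nabla v-a\,wv)\,dx+\sum_{e\in\Gamma^0}\int_e\big(\{\partial_\nu w\}[v]+[w]\{\partial_\nu v\}\big)ds+\frac{\theta}{2}\int_{\Gamma^\partial}\big(\{\partial_\nu w\}[v]+[w]\{\partial_\nu v\}\big)ds,$$ where $\theta=1$ in the periodic case (i) (opposite boundary faces are identified, averages and jumps being taken across the identification, and the factor $1/2$ avoids counting each identified pair twice) and $\theta=0$ in case (ii). The operator $L_h:V_h\to V_h$ is defined by $(L_hv,\phi)=G(v,\phi)$ for all $\phi\in V_h$. Energy quadratization. $C_0$ is a constant such that $\Phi(w)+C_0>0$ for all $w\in\mathbb R$, and $H(w)=\Phi'(w)/\sqrt{\Phi(w)+C_0}$. The functions $l_i,\tilde U_i,U^{n+1}$ are functions on $\Omega$ defined pointwise and need not lie in $V_h$. The given functions $u_{ih}^{n,*}$ are approximations of the solution at time $t_n+c_i\tau$ computed beforehand (by extrapolation or prediction).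
   Formalization: Existence is proved with the ξ-equations imposed only for stages with b_i≠0, since equations of stages with b_i=0 can be unsolvable; uniqueness of the triple and energy stability also cover the full scheme. Mesh elements are read as compact convex sets. *)

theory Defs
  imports "HOL-Analysis.Analysis"
begin

section \<open>Polynomials, gradients and integrals over flat faces\<close>

definition multi_indices :: "nat \<Rightarrow> ('a::euclidean_space \<Rightarrow> nat) set" where
  "multi_indices k = {\<alpha>. (\<forall>i. i \<notin> Basis \<longrightarrow> \<alpha> i = 0) \<and> (\<Sum>i\<in>Basis. \<alpha> i) \<le> k}"

definition poly_space :: "nat \<Rightarrow> ('a::euclidean_space \<Rightarrow> real) set" where
  "poly_space k =
     {p. \<exists>c. \<forall>x. p x = (\<Sum>\<alpha>\<in>multi_indices k. c \<alpha> * (\<Prod>i\<in>Basis. (x \<bullet> i) ^ \<alpha> i))}"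

definition grad :: "('a::euclidean_space \<Rightarrow> real) \<Rightarrow> 'a \<Rightarrow> 'a" where
  "grad p x = (THE D. GDERIV p x :> D)"

text \<open>The surface integral of \<open>f\<close> over a closed convex set \<open>e\<close> lying in a hyperplane with unit
  normal \<open>\<nu>\<close>.  The \<open>(d-1)\<close>-dimensional measure of \<open>A \<subseteq> e\<close> is the volume of the right prism
  of height 1 over \<open>A\<close>, and on the prism over \<open>e\<close> the map \<open>closest_point e\<close> is the orthogonal
  projection \<open>x + t \<nu> \<mapsto> x\<close>.  For \<open>d = 1\<close> this is evaluation of \<open>f\<close> at the point \<open>e\<close>.\<close>

definition face_integral :: "'a::euclidean_space \<Rightarrow> 'a set \<Rightarrow> ('a \<Rightarrow> real) \<Rightarrow> real" where
  "face_integral \<nu> e f =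
     (LINT y | lebesgue_on {x + t *\<^sub>R \<nu> | x t. x \<in> e \<and> 0 \<le> t \<and> t \<le> 1}. f (closest_point e y))"

text \<open>Two convex bodies without common interior points which meet in a set of dimension \<open>d-1\<close>
  have exactly one separating hyperplane, and their intersection lies in it.\<close>

definition is_face :: "'a::euclidean_space set \<Rightarrow> bool" where
  "is_face e \<longleftrightarrow> aff_dim e = int DIM('a) - 1"

definition face_normal :: "'a::euclidean_space set \<Rightarrow> 'a set \<Rightarrow> 'a" where
  "face_normal K1 K2 =
     (SOME \<nu>. norm \<nu> = 1 \<and> (\<exists>c. (\<forall>x\<in>K1. \<nu> \<bullet> x \<le> c) \<and> (\<forall>x\<in>K2. c \<le> \<nu> \<bullet> x)))"

section \<open>Mesh and boundary conditions\<close>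

text \<open>An interior interface \<open>K1 \<inter> K2\<close> is recorded once, as the ordered pair \<open>(K1, K2)\<close> giving
  the (arbitrary) orientation of its normal.  \<open>periods\<close> is a basis of the lattice of periods; it
  is only relevant in the periodic case \<open>theta = 1\<close>; \<open>theta = 0\<close> is the case of the Neumann
  conditions.  \<open>degr\<close> is the polynomial degree \<open>k\<close> and \<open>apar\<close> the number \<open>a\<close> in
  \<open>- (\<Delta> + a)\<close>.\<close>

record 'a dg_setting =
  Omega :: "'a set"
  mesh :: "'a set set"
  interfaces :: "('a set \<times> 'a set) set"
  periods :: "'a set"
  theta :: real
  degr :: nat
  apar :: real

definition shape_regular :: "real \<Rightarrow> 'a::euclidean_space set set \<Rightarrow> bool" where
  "shape_regular \<sigma> T \<longleftrightarrow> (\<forall>K\<in>T. \<exists>x r. 0 < r \<and> ball x r \<subseteq> K \<and> diameter K \<le> \<sigma> * r)"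

definition lattice :: "'a::euclidean_space set \<Rightarrow> 'a set" where
  "lattice P = {\<Sum>p\<in>P. real_of_int (z p) *\<^sub>R p | z. True}"

text \<open>\<open>\<Omega>\<close> is a cell of periodicity, for instance a box with its edge vectors as periods.\<close>

definition period_cell :: "'a::euclidean_space set \<Rightarrow> 'a set \<Rightarrow> bool" where
  "period_cell P \<Omega> \<longleftrightarrow>
     independent P \<and> span P = UNIV \<and>
     (\<Union>l\<in>lattice P. (+) l ` closure \<Omega>) = UNIV \<and>
     (\<forall>l\<in>lattice P - {0}. \<Omega> \<inter> (+) l ` \<Omega> = {})"

definition valid_setting :: "real \<Rightarrow> 'a::euclidean_space dg_setting \<Rightarrow> bool" where
  "valid_setting \<sigma> D \<longleftrightarrow>
     open (Omega D) \<and> convex (Omega D) \<and> Omega D \<noteq> {} \<and>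
     finite (mesh D) \<and> \<Union>(mesh D) = closure (Omega D) \<and>
     (\<forall>K\<in>mesh D. compact K \<and> convex K) \<and>
     (\<forall>K1\<in>mesh D. \<forall>K2\<in>mesh D. K1 \<noteq> K2 \<longrightarrow> interior K1 \<inter> interior K2 = {}) \<and>
     shape_regular \<sigma> (mesh D) \<and>
     interfaces D \<subseteq> {(K1, K2). K1 \<in> mesh D \<and> K2 \<in> mesh D \<and> is_face (K1 \<inter> K2)} \<and>
     (\<forall>K1\<in>mesh D. \<forall>K2\<in>mesh D. is_face (K1 \<inter> K2) \<longrightarrow>
        ((K1, K2) \<in> interfaces D \<longleftrightarrow> (K2, K1) \<notin> interfaces D)) \<and>
     (theta D = 1 \<and> period_cell (periods D) (Omega D) \<or> theta D = 0)"

text \<open>The boundary faces of the periodic case: \<open>(K1, K2, l)\<close> stands for the part of \<open>\<partial>K1\<close> that is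
  identified by the translation \<open>l\<close> with a part of \<open>\<partial>K2\<close>.  The opposite face
  \<open>(K2, K1, - l)\<close> belongs to the set as well.\<close>

definition boundary_faces :: "'a::euclidean_space dg_setting \<Rightarrow> ('a set \<times> 'a set \<times> 'a) set" where
  "boundary_faces D =
     {(K1, K2, l). K1 \<in> mesh D \<and> K2 \<in> mesh D \<and> l \<in> lattice (periods D) - {0} \<and>
        is_face (K1 \<inter> (+) l ` K2)}"

section \<open>The discontinuous Galerkin space and the bilinear form\<close>

text \<open>Elements of \<open>L\<^sup>2(\<Omega>)\<close> are represented by functions, two functions being identified if they
  agree almost everywhere on \<open>\<Omega>\<close>.\<close>

definition eq_on :: "'a::euclidean_space dg_setting \<Rightarrow> ('a \<Rightarrow> real) \<Rightarrow> ('a \<Rightarrow> real) \<Rightarrow> bool" where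
  "eq_on D f g \<longleftrightarrow> (AE x in lebesgue_on (Omega D). f x = g x)"

definition ip :: "'a::euclidean_space dg_setting \<Rightarrow> ('a \<Rightarrow> real) \<Rightarrow> ('a \<Rightarrow> real) \<Rightarrow> real" where
  "ip D f g = (LINT x | lebesgue_on (Omega D). f x * g x)"

definition l2norm :: "'a::euclidean_space dg_setting \<Rightarrow> ('a \<Rightarrow> real) \<Rightarrow> real" where
  "l2norm D f = sqrt (ip D f f)"

definition L2 :: "'a::euclidean_space dg_setting \<Rightarrow> ('a \<Rightarrow> real) set" where
  "L2 D = {f. f \<in> borel_measurable (lebesgue_on (Omega D)) \<and>
              integrable (lebesgue_on (Omega D)) (\<lambda>x. (f x)\<^sup>2)}"

definition Vh :: "'a::euclidean_space dg_setting \<Rightarrow> ('a \<Rightarrow> real) set" where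
  "Vh D = {v \<in> L2 D. \<forall>K\<in>mesh D. \<exists>p\<in>poly_space (degr D). AE x in lebesgue_on K. v x = p x}"

text \<open>The polynomial that represents \<open>v \<in> Vh\<close> on \<open>K\<close>; its values on \<open>\<partial>K\<close> are the traces of
  \<open>v\<close> from \<open>K\<close>.\<close>

definition piece :: "'a::euclidean_space dg_setting \<Rightarrow> 'a set \<Rightarrow> ('a \<Rightarrow> real) \<Rightarrow> 'a \<Rightarrow> real" where
  "piece D K v = (THE p. p \<in> poly_space (degr D) \<and> (AE x in lebesgue_on K. v x = p x))"

text \<open>Jump and average of the normal derivative on \<open>K1 \<inter> (l + K2)\<close>; a point \<open>x\<close> of this face,
  seen from \<open>K2\<close>, is \<open>x - l\<close>.  Interior interfaces have \<open>l = 0\<close>.\<close>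

definition jump ::
  "'a::euclidean_space dg_setting \<Rightarrow> 'a set \<Rightarrow> 'a set \<Rightarrow> 'a \<Rightarrow> ('a \<Rightarrow> real) \<Rightarrow> 'a \<Rightarrow> real" where
  "jump D K1 K2 l v x = piece D K2 v (x - l) - piece D K1 v x"

definition avg_dn ::
  "'a::euclidean_space dg_setting \<Rightarrow> 'a set \<Rightarrow> 'a set \<Rightarrow> 'a \<Rightarrow> 'a \<Rightarrow> ('a \<Rightarrow> real) \<Rightarrow> 'a \<Rightarrow> real" where
  "avg_dn D K1 K2 l \<nu> v x =
     (\<nu> \<bullet> grad (piece D K1 v) x + \<nu> \<bullet> grad (piece D K2 v) (x - l)) / 2"

definition face_term ::
  "'a::euclidean_space dg_setting \<Rightarrow> 'a set \<Rightarrow> 'a set \<Rightarrow> 'a \<Rightarrow>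
     ('a \<Rightarrow> real) \<Rightarrow> ('a \<Rightarrow> real) \<Rightarrow> real" where
  "face_term D K1 K2 l w v =
     (let \<nu> = face_normal K1 ((+) l ` K2) in
      face_integral \<nu> (K1 \<inter> (+) l ` K2)
        (\<lambda>x. avg_dn D K1 K2 l \<nu> w x * jump D K1 K2 l v x
            + jump D K1 K2 l w x * avg_dn D K1 K2 l \<nu> v x))"

definition G :: "'a::euclidean_space dg_setting \<Rightarrow> ('a \<Rightarrow> real) \<Rightarrow> ('a \<Rightarrow> real) \<Rightarrow> real" where
  "G D w v =
     (\<Sum>K\<in>mesh D. LINT x | lebesgue_on K.
        grad (piece D K w) x \<bullet> grad (piece D K v) x - apar D * piece D K w x * piece D K v x)
     + (\<Sum>(K1, K2)\<in>interfaces D. face_term D K1 K2 0 w v)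
     + theta D / 2 * (\<Sum>(K1, K2, l)\<in>boundary_faces D. face_term D K1 K2 l w v)"

definition Lh :: "'a::euclidean_space dg_setting \<Rightarrow> ('a \<Rightarrow> real) \<Rightarrow> ('a \<Rightarrow> real)" where
  "Lh D v = (SOME w. w \<in> Vh D \<and> (\<forall>\<phi>\<in>Vh D. ip D w \<phi> = G D v \<phi>))"

definition L2proj :: "'a::euclidean_space dg_setting \<Rightarrow> ('a \<Rightarrow> real) \<Rightarrow> ('a \<Rightarrow> real)" where
  "L2proj D f = (SOME w. w \<in> Vh D \<and> (\<forall>\<phi>\<in>Vh D. ip D w \<phi> = ip D f \<phi>))"

section \<open>Runge--Kutta methods and the LEQRK-DG scheme\<close>

definition RK_M :: "(nat \<Rightarrow> nat \<Rightarrow> real) \<Rightarrow> (nat \<Rightarrow> real) \<Rightarrow> nat \<Rightarrow> nat \<Rightarrow> real" where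
  "RK_M A b i j = b i * A i j + b j * A j i - b i * b j"

definition algebraically_stable ::
  "nat \<Rightarrow> (nat \<Rightarrow> nat \<Rightarrow> real) \<Rightarrow> (nat \<Rightarrow> real) \<Rightarrow> bool" where
  "algebraically_stable s A b \<longleftrightarrow>
     (\<forall>i\<in>{1..s}. 0 \<le> b i) \<and>
     (\<forall>y :: nat \<Rightarrow> real. 0 \<le> (\<Sum>i=1..s. \<Sum>j=1..s. y i * RK_M A b i j * y j))"

definition H :: "(real \<Rightarrow> real) \<Rightarrow> real \<Rightarrow> real \<Rightarrow> real" where
  "H \<Phi> C0 w = deriv \<Phi> w / sqrt (\<Phi> w + C0)"

definition stage_l :: "(real \<Rightarrow> real) \<Rightarrow> real \<Rightarrow> (nat \<Rightarrow> 'a \<Rightarrow> real) \<Rightarrow>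
    (nat \<Rightarrow> 'a \<Rightarrow> real) \<Rightarrow> nat \<Rightarrow> 'a \<Rightarrow> real" where
  "stage_l \<Phi> C0 ustar \<xi> i x = 1 / 2 * H \<Phi> C0 (ustar i x) * \<xi> i x"

text \<open>Stage value: \<open>v + \<tau> \<Sum>\<^sub>j a\<^sub>i\<^sub>j f\<^sub>j\<close>; new value: \<open>v + \<tau> \<Sum>\<^sub>i b\<^sub>i f\<^sub>i\<close>.\<close>

definition rk_stage :: "nat \<Rightarrow> (nat \<Rightarrow> nat \<Rightarrow> real) \<Rightarrow> real \<Rightarrow> ('a \<Rightarrow> real) \<Rightarrow>
    (nat \<Rightarrow> 'a \<Rightarrow> real) \<Rightarrow> nat \<Rightarrow> 'a \<Rightarrow> real" where
  "rk_stage s A \<tau> v f i x = v x + \<tau> * (\<Sum>j=1..s. A i j * f j x)"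

definition rk_update :: "nat \<Rightarrow> (nat \<Rightarrow> real) \<Rightarrow> real \<Rightarrow> ('a \<Rightarrow> real) \<Rightarrow>
    (nat \<Rightarrow> 'a \<Rightarrow> real) \<Rightarrow> 'a \<Rightarrow> real" where
  "rk_update s b \<tau> v f x = v x + \<tau> * (\<Sum>i=1..s. b i * f i x)"

text \<open>\<open>leqrk_dg D \<Phi> C0 s A b \<tau> u U ustar J \<xi> q u1 q1 U1\<close>: the new values \<open>u1, q1, U1\<close> are
  obtained from \<open>u, U\<close> by one step with stage unknowns \<open>\<xi>\<^sub>i\<close> and \<open>q\<^sub>i\<close>.  The scheme is the case
  \<open>J = {1..s}\<close>.  In general the equation that determines \<open>\<xi>\<^sub>i\<close> is imposed for \<open>i \<in> J\<close> only.
  This is needed since an algebraically stable method may have stages of weight \<open>b\<^sub>i = 0\<close>.  These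
  influence neither the update nor, by algebraic stability, the stages of positive weight, but
  their own equations can be unsolvable: for \<open>b = (1, 0)\<close>, \<open>A = diag(1/2, - c)\<close> and \<open>\<Phi>\<close>
  constant the second one is \<open>(1 - \<tau> c Lh\<^sup>2) \<xi>\<^sub>2 = - Lh\<^sup>2 u\<close>, which has no solution if
  \<open>Lh u = \<mu> u\<close>, \<open>u \<noteq> 0\<close> and \<open>\<tau> c \<mu>\<^sup>2 = 1\<close>.\<close>

definition leqrk_dg ::
  "'a::euclidean_space dg_setting \<Rightarrow> (real \<Rightarrow> real) \<Rightarrow> real \<Rightarrow> nat \<Rightarrow>
     (nat \<Rightarrow> nat \<Rightarrow> real) \<Rightarrow> (nat \<Rightarrow> real) \<Rightarrow> real \<Rightarrow>
     ('a \<Rightarrow> real) \<Rightarrow> ('a \<Rightarrow> real) \<Rightarrow> (nat \<Rightarrow> 'a \<Rightarrow> real) \<Rightarrow> nat set \<Rightarrow>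
     (nat \<Rightarrow> 'a \<Rightarrow> real) \<Rightarrow> (nat \<Rightarrow> 'a \<Rightarrow> real) \<Rightarrow>
     ('a \<Rightarrow> real) \<Rightarrow> ('a \<Rightarrow> real) \<Rightarrow> ('a \<Rightarrow> real) \<Rightarrow> bool" where
  "leqrk_dg D \<Phi> C0 s A b \<tau> u U ustar J \<xi> q u1 q1 U1 \<longleftrightarrow>
     (\<forall>i\<in>{1..s}. \<xi> i \<in> Vh D \<and> q i \<in> Vh D) \<and>
     (\<forall>i\<in>J. \<forall>\<phi>\<in>Vh D.
        ip D (\<xi> i) \<phi> =
          - G D (q i) \<phi>
          - ip D (\<lambda>x. H \<Phi> C0 (ustar i x) * rk_stage s A \<tau> U (stage_l \<Phi> C0 ustar \<xi>) i x) \<phi>) \<and>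
     (\<forall>i\<in>{1..s}. \<forall>\<psi>\<in>Vh D. ip D (q i) \<psi> = G D (rk_stage s A \<tau> u \<xi> i) \<psi>) \<and>
     u1 \<in> Vh D \<and> q1 \<in> Vh D \<and> U1 \<in> Vh D \<and>
     eq_on D u1 (rk_update s b \<tau> u \<xi>) \<and>
     eq_on D q1 (Lh D u1) \<and>
     eq_on D U1 (L2proj D (rk_update s b \<tau> U (stage_l \<Phi> C0 ustar \<xi>)))"

definition energy :: "'a::euclidean_space dg_setting \<Rightarrow> ('a \<Rightarrow> real) \<Rightarrow> ('a \<Rightarrow> real) \<Rightarrow> real" where
  "energy D q U = 1 / 2 * (l2norm D q)\<^sup>2 + (l2norm D U)\<^sup>2"

end

theory Submission
  imports Defs
begin

text \<open>With \<open>\<eta>\<^sub>i = L\<^sub>h \<xi>\<^sub>i\<close>, the pairs \<open>(q, \<eta>\<^sub>i)\<close> and \<open>(U, l\<^sub>i)\<close> form Runge--Kutta steps.  Algebraic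
  stability gives \<open>y\<^sub>1\<^sup>2 \<le> y\<^sub>0\<^sup>2 + 2\<tau> \<Sum>\<^sub>i b\<^sub>i Y\<^sub>i f\<^sub>i\<close> pointwise for every Runge--Kutta step, because the
  defect is \<open>\<tau>\<^sup>2\<close> times the quadratic form of \<open>M\<close>.  After integration, the two right-hand sides
  combine, by the symmetry of \<open>G\<close> and the stage equation tested with \<open>\<xi>\<^sub>i\<close>, to
  \<open>- \<tau> \<Sum>\<^sub>i b\<^sub>i \<parallel>\<xi>\<^sub>i\<parallel>\<^sup>2\<close>.  Only stages with \<open>b\<^sub>i \<noteq> 0\<close> matter.  For the difference of two solutions the
  data vanish, so the same estimate forces \<open>\<xi>\<^sub>i = 0\<close> for these stages, which is uniqueness.  In an
  orthonormal basis of \<open>V\<^sub>h\<close> the stage equations with \<open>b\<^sub>i \<noteq> 0\<close> (the other \<open>\<xi>\<^sub>i\<close> being set to \<open>0\<close>) are a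
  square linear system with trivial kernel, which gives existence.\<close>

section \<open>Square linear systems\<close>

text \<open>The elements of V_h are functions, and its linear structure is faithful only modulo null
  sets. \<open>Lh\<close> and \<open>L2proj\<close> choose representatives, so they are linear only
  almost everywhere. Identities are therefore proved in weak form, tested against V_h, and turned
  into equalities almost everywhere by testing with a difference. No quotient space is formed, and
  the linear system is indexed by pairs of a stage and a basis function. The functions l_i and the
  stage values of U lie in L2 but in general not in V_h. This is why the stability inequality is
  taken pointwise and integrated, and why the projection enters only at the very end, as a
  contraction. Algebraic stability decouples the stages: if b_j = 0 < b_i, then M_jj = 0, and
  semi-definiteness makes M_ij = b_i a_ij vanish. The proof takes another route. The energy estimate
  weights stage i by b_i, so it tolerates arbitrary elements of V_h in the stages of weight
  0.\<close>

lemma square_system_solvable: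
  fixes M :: "'i \<Rightarrow> 'j \<Rightarrow> real"
  assumes "finite I" "finite J" "card I = card J"
    and "\<And>x. \<forall>i\<in>I. (\<Sum>j\<in>J. M i j * x j) = 0 \<Longrightarrow> \<forall>j\<in>J. x j = 0"
  shows "\<exists>x. \<forall>i\<in>I. (\<Sum>j\<in>J. M i j * x j) = r i"
  using assms(2,1,3,4)
proof (induction J arbitrary: I M r rule: finite_induct)
  case empty
  then show ?case by simp
next
  case (insert q J)
  let ?d = "\<lambda>j. if j = q then 1 else (0::real)"
  \<comment> \<open>If column \<open>q\<close> were zero, the unit vector \<open>?d\<close> would
    lie in the kernel. So there is a pivot.\<close>
  have "\<exists>p\<in>I. M p q \<noteq> 0"
  proof (rule ccontr)
    assume "\<not> ?thesis"
    then have "\<forall>i\<in>I. (\<Sum>j\<in>insert q J. M i j * ?d j) = 0"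
      using insert.hyps by (auto intro!: sum.neutral)
    from insert.prems(3)[OF this] show False by simp
  qed
  then obtain p where p: "p \<in> I" "M p q \<noteq> 0" by blast
  \<comment> \<open>Gaussian elimination: \<open>M'\<close> is the Schur complement of the pivot
    \<open>M p q\<close>, in which row \<open>p\<close> has been used to remove the unknown
    \<open>q\<close> from the other rows.\<close>
  define M' where "M' i j = M i j - M i q * M p j / M p q" for i j
  have elim: "(\<Sum>j\<in>J. M' i j * x j) =
      (\<Sum>j\<in>J. M i j * x j) - M i q / M p q * (\<Sum>j\<in>J. M p j * x j)" for i x
    by (simp add: M'_def sum_distrib_left left_diff_distrib sum_subtractf mult.assoc)
  have upd: "(\<Sum>j\<in>insert q J. M i j * (x(q := y)) j) = M i q * y + (\<Sum>j\<in>J. M i j * x j)" for i x y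
    using insert.hyps by (auto intro!: sum.cong)
  have "\<exists>x. \<forall>i\<in>I - {p}. (\<Sum>j\<in>J. M' i j * x j) = r i - M i q / M p q * r p"
  proof (rule insert.IH)
    show "finite (I - {p})" "card (I - {p}) = card J"
      using insert.prems(1,2) insert.hyps p by auto
    fix x assume x: "\<forall>i\<in>I - {p}. (\<Sum>j\<in>J. M' i j * x j) = 0"
    \<comment> \<open>A kernel vector of \<open>M'\<close> becomes one of \<open>M\<close> if its
      entry at \<open>q\<close> is the value that solves row \<open>p\<close>. Hence injectivity is
      inherited by the smaller system.\<close>
    have "\<forall>i\<in>I. (\<Sum>j\<in>insert q J. M i j * (x(q := - (\<Sum>j\<in>J. M p j * x j) / M p q)) j) = 0"
      using x p unfolding upd elim by (auto simp: field_simps)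
    from insert.prems(3)[OF this] show "\<forall>j\<in>J. x j = 0"
      using insert.hyps by (metis fun_upd_other insertCI)
  qed
  then obtain x where x: "\<forall>i\<in>I - {p}. (\<Sum>j\<in>J. M' i j * x j) = r i - M i q / M p q * r p" ..
  have "\<forall>i\<in>I. (\<Sum>j\<in>insert q J. M i j * (x(q := (r p - (\<Sum>j\<in>J. M p j * x j)) / M p q)) j) = r i"
  proof
    fix i assume "i \<in> I"
    then show "(\<Sum>j\<in>insert q J. M i j * (x(q := (r p - (\<Sum>j\<in>J. M p j * x j)) / M p q)) j) = r i"
    proof (cases "i = p")
      case True
      then show ?thesis unfolding upd using p by simp
    next
      case False
      with x \<open>i \<in> I\<close> have "(\<Sum>j\<in>J. M i j * x j) =
          r i - M i q / M p q * r p + M i q / M p q * (\<Sum>j\<in>J. M p j * x j)"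
        unfolding elim by (auto simp: algebra_simps)
      then show ?thesis unfolding upd by (simp add: algebra_simps diff_divide_distrib)
    qed
  qed
  then show ?case by blast
qed

text \<open>The matrix of \<open>F\<close> is read off on the coordinate vectors
  \<open>?e j\<close>. \<open>F\<close> acts on functions on the whole index type, and a combination
  of the \<open>?e j\<close> agrees with \<open>x\<close> only on \<open>I\<close>. So both the
  kernel argument and the final witness use the combination in place of \<open>x\<close>.\<close>

lemma linear_system_solvable:
  fixes F :: "('i \<Rightarrow> real) \<Rightarrow> 'i \<Rightarrow> real"
  assumes fin: "finite I"
    and add: "\<And>x y i. i \<in> I \<Longrightarrow> F (\<lambda>j. x j + y j) i = F x i + F y i"
    and scale: "\<And>c x i. i \<in> I \<Longrightarrow> F (\<lambda>j. c * x j) i = c * F x i"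
    and kernel: "\<And>x. \<forall>i\<in>I. F x i = 0 \<Longrightarrow> \<forall>i\<in>I. x i = 0"
  shows "\<exists>x. \<forall>i\<in>I. F x i = r i"
proof -
  let ?e = "\<lambda>j k. if k = j then 1 else (0::real)"
  have expand: "F (\<lambda>k. \<Sum>j\<in>S. x j * ?e j k) i = (\<Sum>j\<in>S. F (?e j) i * x j)"
    if "finite S" "i \<in> I" for S x i
    using that(1)
  proof induction
    case empty
    show ?case using scale[OF that(2), of 0 "\<lambda>_. 0"] by simp
  next
    case (insert j S)
    then show ?case by (simp add: add that(2) scale mult.commute[of _ "x j"])
  qed
  have coord: "(\<Sum>j\<in>I. x j * ?e j k) = x k" if "k \<in> I" for x k
    using that fin by (simp add: if_distrib cong: if_cong)
  have "\<exists>x. \<forall>i\<in>I. (\<Sum>j\<in>I. F (?e j) i * x j) = r i"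
  proof (rule square_system_solvable[OF fin fin refl])
    fix x assume "\<forall>i\<in>I. (\<Sum>j\<in>I. F (?e j) i * x j) = 0"
    then have "\<forall>i\<in>I. F (\<lambda>k. \<Sum>j\<in>I. x j * ?e j k) i = 0"
      using expand[OF fin, of _ x] by simp
    from kernel[OF this] show "\<forall>j\<in>I. x j = 0" by (simp add: coord)
  qed
  then obtain x where "\<forall>i\<in>I. (\<Sum>j\<in>I. F (?e j) i * x j) = r i" ..
  then have "\<forall>i\<in>I. F (\<lambda>k. \<Sum>j\<in>I. x j * ?e j k) i = r i"
    using expand[OF fin, of _ x] by simp
  then show ?thesis by (intro exI[of _ "\<lambda>k. \<Sum>j\<in>I. x j * ?e j k"])
qed

section \<open>Polynomials and their gradients\<close>

lemma finite_multi_indices: "finite (multi_indices k :: ('a::euclidean_space \<Rightarrow> nat) set)"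
proof (rule finite_subset)
  let ?S = "{\<alpha>. \<forall>i::'a. (i \<in> Basis \<longrightarrow> \<alpha> i \<in> {..k}) \<and> (i \<notin> Basis \<longrightarrow> \<alpha> i = 0)}"
  have "\<alpha> i \<le> k" if "(\<Sum>i\<in>Basis. \<alpha> i) \<le> k" "i \<in> Basis" for \<alpha> and i :: 'a
    using that member_le_sum[of i Basis \<alpha>] by force
  then show "multi_indices k \<subseteq> ?S" by (auto simp: multi_indices_def)
  show "finite ?S" by (rule finite_set_of_finite_funs) auto
qed

definition monomial :: "('a::euclidean_space \<Rightarrow> nat) \<Rightarrow> 'a \<Rightarrow> real" where
  "monomial \<alpha> x = (\<Prod>i\<in>Basis. (x \<bullet> i) ^ \<alpha> i)"

lemma poly_space_iff:
  "p \<in> poly_space k \<longleftrightarrow> (\<exists>c. p = (\<lambda>x. \<Sum>\<alpha>\<in>multi_indices k. c \<alpha> * monomial \<alpha> x))"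
  by (auto simp: poly_space_def monomial_def fun_eq_iff)

lemma monomial_in_poly_space:
  assumes "\<alpha> \<in> multi_indices k"
  shows "monomial \<alpha> \<in> poly_space k"
proof -
  have "monomial \<alpha> = (\<lambda>x. \<Sum>\<beta>\<in>multi_indices k. (if \<beta> = \<alpha> then 1 else 0) * monomial \<beta> x)"
    (is "_ = ?rhs")
  proof
    show "monomial \<alpha> x = ?rhs x" for x
      using assms by (simp add: finite_multi_indices if_distrib[of "\<lambda>c. c * _"] cong: if_cong)
  qed
  then show ?thesis unfolding poly_space_iff by auto
qed

lemma poly_space_linear:
  assumes "p \<in> poly_space k" "q \<in> poly_space k"
  shows "(\<lambda>x. a * p x + b * q x) \<in> poly_space k"
proof -
  from assms obtain c d where "p = (\<lambda>x. \<Sum>\<alpha>\<in>multi_indices k. c \<alpha> * monomial \<alpha> x)"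
    "q = (\<lambda>x. \<Sum>\<alpha>\<in>multi_indices k. d \<alpha> * monomial \<alpha> x)"
    unfolding poly_space_iff by auto
  then have "(\<lambda>x. a * p x + b * q x) =
      (\<lambda>x. \<Sum>\<alpha>\<in>multi_indices k. (a * c \<alpha> + b * d \<alpha>) * monomial \<alpha> x)"
    by (simp add: sum_distrib_left sum.distrib algebra_simps)
  then show ?thesis unfolding poly_space_iff by (intro exI[of _ "\<lambda>\<alpha>. a * c \<alpha> + b * d \<alpha>"])
qed

lemma zero_in_poly_space: "(\<lambda>x. 0) \<in> poly_space k"
  unfolding poly_space_iff by (intro exI[of _ "\<lambda>_. 0"]) simp

section \<open>Continuously differentiable functions and their gradients\<close>

definition C1_fun :: "('a::real_inner \<Rightarrow> real) \<Rightarrow> bool" where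
  "C1_fun p \<longleftrightarrow> (\<exists>g. continuous_on UNIV g \<and> (\<forall>x. GDERIV p x :> g x))"

lemma C1_fun_continuous: "C1_fun p \<Longrightarrow> continuous_on S p"
  unfolding C1_fun_def gderiv_def
  by (blast intro: continuous_at_imp_continuous_on has_derivative_continuous)

lemma C1_fun_const: "C1_fun (\<lambda>x. c)"
  unfolding C1_fun_def by (intro exI[of _ "\<lambda>x. 0"] conjI continuous_on_const allI GDERIV_const)

lemma C1_fun_inner: "C1_fun (\<lambda>x. x \<bullet> i)"
  unfolding C1_fun_def gderiv_def
  by (intro exI[of _ "\<lambda>x. i"] conjI continuous_on_const allI has_derivative_inner_left has_derivative_ident)

lemma C1_fun_add:
  assumes "C1_fun p" "C1_fun q"
  shows "C1_fun (\<lambda>x. p x + q x)"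
proof -
  from assms obtain f g where "continuous_on UNIV f" "\<forall>x. GDERIV p x :> f x"
    "continuous_on UNIV g" "\<forall>x. GDERIV q x :> g x"
    unfolding C1_fun_def by (elim exE conjE)
  then show ?thesis
    unfolding C1_fun_def
    by (intro exI[of _ "\<lambda>x. f x + g x"] conjI continuous_on_add allI GDERIV_add) simp_all
qed

lemma C1_fun_mult:
  assumes "C1_fun p" "C1_fun q"
  shows "C1_fun (\<lambda>x. p x * q x)"
proof -
  from assms obtain f g where "continuous_on UNIV f" "\<forall>x. GDERIV p x :> f x"
    "continuous_on UNIV g" "\<forall>x. GDERIV q x :> g x"
    unfolding C1_fun_def by (elim exE conjE)
  then show ?thesis
    unfolding C1_fun_def
    by (intro exI[of _ "\<lambda>x. p x *\<^sub>R g x + q x *\<^sub>R f x"] conjI continuous_on_add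
        continuous_on_scaleR C1_fun_continuous assms allI GDERIV_mult) simp_all
qed

lemma C1_fun_power: "C1_fun p \<Longrightarrow> C1_fun (\<lambda>x. p x ^ n)"
  by (induction n) (auto intro: C1_fun_const C1_fun_mult)

lemma C1_fun_prod: "(\<And>i. i \<in> I \<Longrightarrow> C1_fun (p i)) \<Longrightarrow> C1_fun (\<lambda>x. \<Prod>i\<in>I. p i x)"
  by (induction I rule: infinite_finite_induct) (auto intro: C1_fun_const C1_fun_mult)

lemma C1_fun_sum: "(\<And>i. i \<in> I \<Longrightarrow> C1_fun (p i)) \<Longrightarrow> C1_fun (\<lambda>x. \<Sum>i\<in>I. p i x)"
  by (induction I rule: infinite_finite_induct) (auto intro: C1_fun_const C1_fun_add)

lemma poly_space_C1: "p \<in> poly_space k \<Longrightarrow> C1_fun p"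
  unfolding poly_space_iff monomial_def
  by (elim exE, erule ssubst)
    (rule C1_fun_sum C1_fun_mult C1_fun_const C1_fun_prod C1_fun_power C1_fun_inner)+

lemma grad_eqI:
  assumes "GDERIV p x :> D"
  shows "grad p x = D"
  unfolding grad_def
proof (rule the_equality[where P = "\<lambda>D. GDERIV p x :> D", OF assms])
  fix D' assume "GDERIV p x :> D'"
  with assms have "(\<lambda>h. h \<bullet> D) = (\<lambda>h. h \<bullet> D')"
    unfolding gderiv_def by (rule has_derivative_unique)
  then show "D' = D" by (simp add: fun_eq_iff vector_eq_ldot)
qed

text \<open>\<open>grad\<close> is a definite description and says something only where a gradient
  exists. \<open>C1_fun\<close> provides one without naming it, which makes it easy to propagate
  through sums and products; uniqueness of the derivative then identifies it with
  \<open>grad\<close>.\<close>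

lemma C1_fun_grad: "C1_fun p \<Longrightarrow> GDERIV p x :> grad p x"
  unfolding C1_fun_def by (elim exE conjE allE[of _ x]) (simp only: grad_eqI)

lemma continuous_on_grad:
  assumes "C1_fun p"
  shows "continuous_on S (grad p)"
proof -
  from assms obtain g where g: "continuous_on UNIV g" "\<forall>x. GDERIV p x :> g x"
    unfolding C1_fun_def by blast
  then have "grad p = g" by (intro ext grad_eqI) simp
  with g(1) show ?thesis by (auto intro: continuous_on_subset)
qed

lemma grad_linear:
  assumes "C1_fun p" "C1_fun q"
  shows "grad (\<lambda>x. a * p x + b * q x) x = a *\<^sub>R grad p x + b *\<^sub>R grad q x"
proof (rule grad_eqI)
  have "GDERIV (\<lambda>x. a * p x) x :> a *\<^sub>R grad p x"
    using GDERIV_mult[OF GDERIV_const[of a] C1_fun_grad[OF assms(1)]] by simp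
  moreover have "GDERIV (\<lambda>x. b * q x) x :> b *\<^sub>R grad q x"
    using GDERIV_mult[OF GDERIV_const[of b] C1_fun_grad[OF assms(2)]] by simp
  ultimately show "GDERIV (\<lambda>x. a * p x + b * q x) x :> a *\<^sub>R grad p x + b *\<^sub>R grad q x"
    by (rule GDERIV_add)
qed

section \<open>Identity theorem for polynomials and almost everywhere equality\<close>

lemma poly_space_line:
  assumes "p \<in> poly_space k"
  shows "\<exists>P. \<forall>t. p (x + t *\<^sub>R d) = poly P t"
proof -
  from assms obtain c where c: "p = (\<lambda>x. \<Sum>\<alpha>\<in>multi_indices k. c \<alpha> * monomial \<alpha> x)"
    unfolding poly_space_iff by (elim exE)
  let ?P = "\<Sum>\<alpha>\<in>multi_indices k. smult (c \<alpha>) (\<Prod>i\<in>Basis. [:x \<bullet> i, d \<bullet> i:] ^ \<alpha> i)"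
  have "p (x + t *\<^sub>R d) = poly ?P t" for t
    by (simp only: c monomial_def poly_sum poly_prod poly_smult poly_power poly_pCons poly_0
        inner_add_left inner_scaleR_left mult_zero_right add_0_right)
  then show ?thesis by (intro exI[of _ ?P] allI)
qed

text \<open>Restricted to the line through the centre and \<open>y\<close>, the polynomial is
  univariate and has infinitely many roots near the centre, so it vanishes identically. The
  parameter value 1 corresponds to \<open>y\<close>.\<close>

lemma poly_space_zero_on_ball:
  assumes "p \<in> poly_space k" "0 < r" "\<And>x. x \<in> ball x0 r \<Longrightarrow> p x = 0"
  shows "p y = 0"
proof (cases "y = x0")
  case True
  with assms(2,3) show ?thesis by simp
next
  case False
  from poly_space_line[OF assms(1), of x0 "y - x0"] obtain P
    where P: "\<forall>t. p (x0 + t *\<^sub>R (y - x0)) = poly P t" by (elim exE)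
  \<comment> \<open>For 0 < t < \<open>?\<delta>\<close> the point
    \<open>x0 + t *\<^sub>R (y - x0)\<close> is at distance less than \<open>r\<close> from the
    centre.\<close>
  let ?\<delta> = "r / norm (y - x0)"
  have "0 < ?\<delta>" using assms(2) False by simp
  have "poly P t = 0" if "t \<in> {0<..<?\<delta>}" for t
  proof -
    have "x0 + t *\<^sub>R (y - x0) \<in> ball x0 r"
      using that False by (simp add: dist_norm pos_less_divide_eq)
    from assms(3)[OF this] show ?thesis using P by simp
  qed
  then have "{0<..<?\<delta>} \<subseteq> {t. poly P t = 0}" by blast
  then have "infinite {t. poly P t = 0}"
    using infinite_super infinite_Ioo[OF \<open>0 < ?\<delta>\<close>] by blast
  then have "P = 0" using poly_roots_finite[of P] by blast
  then show ?thesis using P[rule_format, of 1] by simp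
qed

text \<open>By continuity the points of the ball with nonzero value form an open set, and a nonempty
  open set is not negligible.\<close>

lemma continuous_AE_zero_on_ball:
  fixes f :: "'a::euclidean_space \<Rightarrow> real"
  assumes "continuous_on UNIV f" "AE x in lebesgue_on K. f x = 0" "ball x0 r \<subseteq> K" "K \<in> sets lebesgue"
    and "x \<in> ball x0 r"
  shows "f x = 0"
proof (rule ccontr)
  assume "f x \<noteq> 0"
  let ?U = "ball x0 r \<inter> {x. f x \<noteq> 0}"
  have "open ?U"
    using assms(1) by (intro open_Int open_ball open_Collect_neq continuous_on_const)
  moreover have "?U \<noteq> {}" using \<open>f x \<noteq> 0\<close> assms(5) by blast
  ultimately have "\<not> negligible ?U" by (rule open_not_negligible)
  moreover have "negligible ?U"
  proof -
    have "AE x in lebesgue. x \<in> K \<longrightarrow> f x = 0"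
      using assms(2,4) by (simp add: AE_restrict_space_iff)
    then have "AE x in lebesgue. x \<notin> ?U" by (rule eventually_mono) (use assms(3) in auto)
    moreover have "?U \<in> sets lebesgue" using \<open>open ?U\<close> by auto
    ultimately show ?thesis
      by (simp only: negligible_iff_null_sets AE_iff_null_sets)
  qed
  ultimately show False by blast
qed

section \<open>The discontinuous Galerkin space and the form G\<close>

text \<open>Every integral in \<open>G\<close> has this form: the domains are mesh elements or
  prisms over faces, and the integrands are continuous.\<close>

lemma integrable_continuous_compact:
  fixes f :: "'a::euclidean_space \<Rightarrow> real"
  assumes "continuous_on S f" "compact S"
  shows "integrable (lebesgue_on S) f"
proof -
  have S: "S \<in> lmeasurable" using assms(2) by (rule lmeasurable_compact)
  then interpret finite_measure "lebesgue_on S" by (rule finite_measure_lebesgue_on)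
  from compact_imp_bounded[OF compact_continuous_image[OF assms]]
  obtain B where "\<forall>x\<in>S. norm (f x) \<le> B" unfolding bounded_iff by auto
  then show ?thesis
    using S continuous_imp_measurable_on_sets_lebesgue[OF assms(1)]
    by (intro integrable_const_bound[of _ B]) (auto intro: AE_I2 simp: space_restrict_space)
qed

section \<open>The mesh and its null sets\<close>

locale dg =
  fixes D :: "'a::euclidean_space dg_setting" and \<sigma> :: real
  assumes valid: "valid_setting \<sigma> D"
begin

lemma finite_mesh: "finite (mesh D)"
  and open_Omega: "open (Omega D)"
  and convex_Omega: "convex (Omega D)"
  and Union_mesh: "\<Union>(mesh D) = closure (Omega D)"
  using valid by (simp_all add: valid_setting_def)

lemma compact_mesh: "K \<in> mesh D \<Longrightarrow> compact K"
  and convex_mesh: "K \<in> mesh D \<Longrightarrow> convex K"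
  using valid by (simp_all add: valid_setting_def)

lemma interior_mesh_disjoint:
  "K \<in> mesh D \<Longrightarrow> K' \<in> mesh D \<Longrightarrow> K \<noteq> K' \<Longrightarrow> interior K \<inter> interior K' = {}"
  using valid by (simp add: valid_setting_def)

lemma mesh_ball:
  assumes "K \<in> mesh D"
  obtains x r where "0 < r" "ball x r \<subseteq> K"
proof -
  from valid have "shape_regular \<sigma> (mesh D)" by (simp add: valid_setting_def)
  with assms that show thesis unfolding shape_regular_def by blast
qed

lemma interfaces_face: "(K1, K2) \<in> interfaces D \<Longrightarrow> K1 \<in> mesh D \<and> K2 \<in> mesh D \<and> is_face (K1 \<inter> K2)"
  using valid by (auto simp: valid_setting_def)

lemma sets_mesh: "K \<in> mesh D \<Longrightarrow> K \<in> sets lebesgue"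
  using lmeasurable_compact[OF compact_mesh] by (rule fmeasurableD)

lemma lmeasurable_Omega: "Omega D \<in> lmeasurable"
proof (rule lmeasurable_open[OF _ open_Omega])
  have "bounded (\<Union>(mesh D))"
    using finite_mesh compact_mesh by (auto intro: compact_imp_bounded)
  then show "bounded (Omega D)"
    unfolding Union_mesh using closure_subset by (rule bounded_subset)
qed

lemma sets_Omega: "Omega D \<in> sets lebesgue"
  using lmeasurable_Omega by (rule fmeasurableD)

text \<open>The elements cover the closure of \<Omega>, which differs from the open set \<Omega>
  only by the frontier of a convex set, a null set. Finitely many elements allow the quantifier over
  the mesh to be exchanged with "almost everywhere". This connects the elementwise definition of
  \<open>Vh\<close> with integrals over \<Omega>.\<close>

lemma AE_Omega_iff:
  "(AE x in lebesgue_on (Omega D). P x) \<longleftrightarrow> (\<forall>K\<in>mesh D. AE x in lebesgue_on K. P x)"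
proof -
  have "negligible (frontier (Omega D))"
    using convex_Omega by (rule negligible_convex_frontier)
  then have null: "AE x in lebesgue. x \<notin> frontier (Omega D)"
    by (intro AE_not_in) (simp add: negligible_iff_null_sets)
  have "(\<forall>K\<in>mesh D. AE x in lebesgue_on K. P x) \<longleftrightarrow> (\<forall>K\<in>mesh D. AE x in lebesgue. x \<in> K \<longrightarrow> P x)"
    by (intro ball_cong refl AE_restrict_space_iff) (simp add: sets_mesh)
  also have "\<dots> \<longleftrightarrow> (AE x in lebesgue. \<forall>K\<in>mesh D. x \<in> K \<longrightarrow> P x)"
    by (rule AE_ball_countable[symmetric]) (simp add: finite_mesh countable_finite)
  also have "\<dots> \<longleftrightarrow> (AE x in lebesgue. x \<in> closure (Omega D) \<longrightarrow> P x)"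
    by (intro eventually_cong[OF AE_I2[OF TrueI]]) (auto simp flip: Union_mesh)
  also have "\<dots> \<longleftrightarrow> (AE x in lebesgue. x \<in> Omega D \<longrightarrow> P x)"
    by (intro eventually_cong[OF null]) (use closure_subset in \<open>auto simp: frontier_def interior_open[OF open_Omega]\<close>)
  also have "\<dots> \<longleftrightarrow> (AE x in lebesgue_on (Omega D). P x)"
    by (rule AE_restrict_space_iff[symmetric]) (simp add: sets_Omega)
  finally show ?thesis by simp
qed

text \<open>Shape regularity gives a ball inside \<open>K\<close>, on which the difference of the
  polynomials vanishes everywhere by continuity. This is what makes the definite description in
  \<open>piece\<close> well defined.\<close>

lemma poly_space_AE_unique:
  assumes K: "K \<in> mesh D" and p: "p \<in> poly_space k" and q: "q \<in> poly_space k"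
    and eq: "AE x in lebesgue_on K. p x = q x"
  shows "p = q"
proof
  fix y
  from K obtain x0 r where r: "0 < r" "ball x0 r \<subseteq> K" by (rule mesh_ball)
  let ?d = "\<lambda>x. 1 * p x + (-1) * q x"
  have d: "?d \<in> poly_space k" using p q by (rule poly_space_linear)
  have "?d y = 0"
  proof (rule poly_space_zero_on_ball[OF d r(1)])
    fix x assume "x \<in> ball x0 r"
    moreover have "AE x in lebesgue_on K. ?d x = 0" using eq by (rule eventually_mono) simp
    ultimately show "?d x = 0"
      using C1_fun_continuous[OF poly_space_C1[OF d]] r(2) sets_mesh[OF K]
      by (intro continuous_AE_zero_on_ball[of ?d]) auto
  qed
  then show "p y = q y" by simp
qed

section \<open>The polynomial pieces of an element of V_h\<close>

lemma piece_eqI: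
  assumes "K \<in> mesh D" "p \<in> poly_space (degr D)" "AE x in lebesgue_on K. v x = p x"
  shows "piece D K v = p"
  unfolding piece_def
proof (rule the_equality)
  show "p \<in> poly_space (degr D) \<and> (AE x in lebesgue_on K. v x = p x)" using assms by blast
  fix q assume q: "q \<in> poly_space (degr D) \<and> (AE x in lebesgue_on K. v x = q x)"
  with assms(3) have "AE x in lebesgue_on K. q x = p x" by auto
  with q assms show "q = p" by (intro poly_space_AE_unique[of K]) auto
qed

lemma Vh_piece:
  assumes "v \<in> Vh D" "K \<in> mesh D"
  shows "piece D K v \<in> poly_space (degr D)" "AE x in lebesgue_on K. v x = piece D K v x"
proof -
  from assms obtain p where "p \<in> poly_space (degr D)" "AE x in lebesgue_on K. v x = p x"
    unfolding Vh_def by blast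
  moreover from this have "piece D K v = p" by (rule piece_eqI[OF assms(2)])
  ultimately show "piece D K v \<in> poly_space (degr D)" "AE x in lebesgue_on K. v x = piece D K v x"
    by simp_all
qed

lemma piece_C1: "v \<in> Vh D \<Longrightarrow> K \<in> mesh D \<Longrightarrow> C1_fun (piece D K v)"
  by (rule poly_space_C1[OF Vh_piece(1)])

lemma piece_linear:
  assumes "v \<in> Vh D" "w \<in> Vh D" "K \<in> mesh D"
  shows "piece D K (\<lambda>x. a * v x + b * w x) = (\<lambda>x. a * piece D K v x + b * piece D K w x)"
proof (rule piece_eqI[OF assms(3)])
  show "(\<lambda>x. a * piece D K v x + b * piece D K w x) \<in> poly_space (degr D)"
    using assms by (intro poly_space_linear Vh_piece)
  show "AE x in lebesgue_on K. a * v x + b * w x = a * piece D K v x + b * piece D K w x"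
    using Vh_piece(2)[OF assms(1,3)] Vh_piece(2)[OF assms(2,3)] by eventually_elim simp
qed

lemma piece_cong:
  assumes "w \<in> Vh D" "eq_on D v w" "K \<in> mesh D"
  shows "piece D K v = piece D K w"
proof (rule piece_eqI[OF assms(3) Vh_piece(1)[OF assms(1,3)]])
  from assms(2,3) have "AE x in lebesgue_on K. v x = w x"
    by (simp add: eq_on_def AE_Omega_iff)
  with Vh_piece(2)[OF assms(1,3)] show "AE x in lebesgue_on K. v x = piece D K w x"
    by eventually_elim simp
qed

section \<open>The inner product on L2 and equality almost everywhere\<close>

lemma L2_measurable: "f \<in> L2 D \<Longrightarrow> f \<in> borel_measurable (lebesgue_on (Omega D))"
  and L2_integrable_square: "f \<in> L2 D \<Longrightarrow> integrable (lebesgue_on (Omega D)) (\<lambda>x. (f x)\<^sup>2)"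
  by (simp_all add: L2_def)

lemma L2_integrable_mult:
  assumes "f \<in> L2 D" "g \<in> L2 D"
  shows "integrable (lebesgue_on (Omega D)) (\<lambda>x. f x * g x)"
proof (rule Bochner_Integration.integrable_bound)
  show "integrable (lebesgue_on (Omega D)) (\<lambda>x. (f x)\<^sup>2 + (g x)\<^sup>2)"
    using assms by (intro Bochner_Integration.integrable_add L2_integrable_square)
  show "(\<lambda>x. f x * g x) \<in> borel_measurable (lebesgue_on (Omega D))"
    using assms by (intro borel_measurable_times L2_measurable)
  have "\<bar>a * b\<bar> \<le> a\<^sup>2 + b\<^sup>2" for a b :: real
  proof -
    have "2 * (\<bar>a\<bar> * \<bar>b\<bar>) \<le> a\<^sup>2 + b\<^sup>2"
      using sum_squares_bound[of "\<bar>a\<bar>" "\<bar>b\<bar>"] by simp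
    moreover have "0 \<le> \<bar>a\<bar> * \<bar>b\<bar>" by simp
    ultimately show ?thesis unfolding abs_mult by linarith
  qed
  then show "AE x in lebesgue_on (Omega D). norm (f x * g x) \<le> norm ((f x)\<^sup>2 + (g x)\<^sup>2)"
    by simp
qed

lemma L2_linear:
  assumes "f \<in> L2 D" "g \<in> L2 D"
  shows "(\<lambda>x. a * f x + b * g x) \<in> L2 D"
proof -
  have "(\<lambda>x. (a * f x + b * g x)\<^sup>2) =
      (\<lambda>x. a\<^sup>2 * (f x)\<^sup>2 + 2 * a * b * (f x * g x) + b\<^sup>2 * (g x)\<^sup>2)"
    by (simp add: fun_eq_iff power2_sum power_mult_distrib)
  moreover have "integrable (lebesgue_on (Omega D)) \<dots>"
    using assms by (intro Bochner_Integration.integrable_add integrable_mult_right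
        L2_integrable_square L2_integrable_mult)
  moreover have "(\<lambda>x. a * f x + b * g x) \<in> borel_measurable (lebesgue_on (Omega D))"
    using assms by (intro borel_measurable_add borel_measurable_times borel_measurable_const L2_measurable)
  ultimately show ?thesis by (simp add: L2_def)
qed

lemma Vh_L2: "v \<in> Vh D \<Longrightarrow> v \<in> L2 D"
  by (simp add: Vh_def)

lemma Vh_linear:
  assumes "v \<in> Vh D" "w \<in> Vh D"
  shows "(\<lambda>x. a * v x + b * w x) \<in> Vh D"
  unfolding Vh_def
proof (intro CollectI conjI ballI)
  show "(\<lambda>x. a * v x + b * w x) \<in> L2 D" using assms by (intro L2_linear Vh_L2)
  fix K assume K: "K \<in> mesh D"
  show "\<exists>p\<in>poly_space (degr D). AE x in lebesgue_on K. a * v x + b * w x = p x"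
  proof
    show "(\<lambda>x. a * piece D K v x + b * piece D K w x) \<in> poly_space (degr D)"
      using assms K by (intro poly_space_linear Vh_piece)
    show "AE x in lebesgue_on K. a * v x + b * w x = a * piece D K v x + b * piece D K w x"
      using Vh_piece(2)[OF assms(1) K] Vh_piece(2)[OF assms(2) K] by eventually_elim simp
  qed
qed

lemma Vh_zero: "(\<lambda>x. 0) \<in> Vh D"
  unfolding Vh_def L2_def by (auto intro!: bexI[OF _ zero_in_poly_space])

lemma L2_zero: "(\<lambda>x. 0) \<in> L2 D"
  using Vh_zero by (rule Vh_L2)

lemma L2_scale: "f \<in> L2 D \<Longrightarrow> (\<lambda>x. c * f x) \<in> L2 D"
  using L2_linear[of f f c 0] by simp

lemma L2_add: "f \<in> L2 D \<Longrightarrow> g \<in> L2 D \<Longrightarrow> (\<lambda>x. f x + g x) \<in> L2 D"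
  using L2_linear[of f g 1 1] by simp

lemma L2_sum: "(\<And>i. i \<in> I \<Longrightarrow> f i \<in> L2 D) \<Longrightarrow> (\<lambda>x. \<Sum>i\<in>I. c i * f i x) \<in> L2 D"
  by (induction I rule: infinite_finite_induct) (simp_all add: L2_zero L2_add[OF L2_scale])

lemma Vh_scale: "v \<in> Vh D \<Longrightarrow> (\<lambda>x. c * v x) \<in> Vh D"
  using Vh_linear[of v v c 0] by simp

lemma Vh_add: "v \<in> Vh D \<Longrightarrow> w \<in> Vh D \<Longrightarrow> (\<lambda>x. v x + w x) \<in> Vh D"
  using Vh_linear[of v w 1 1] by simp

lemma Vh_diff: "v \<in> Vh D \<Longrightarrow> w \<in> Vh D \<Longrightarrow> (\<lambda>x. v x - w x) \<in> Vh D"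
  using Vh_linear[of v w 1 "-1"] by simp

lemma L2_diff: "f \<in> L2 D \<Longrightarrow> g \<in> L2 D \<Longrightarrow> (\<lambda>x. f x - g x) \<in> L2 D"
  using L2_linear[of f g 1 "-1"] by simp

lemma Vh_sum: "(\<And>i. i \<in> I \<Longrightarrow> v i \<in> Vh D) \<Longrightarrow> (\<lambda>x. \<Sum>i\<in>I. c i * v i x) \<in> Vh D"
  by (induction I rule: infinite_finite_induct) (simp_all add: Vh_zero Vh_add[OF Vh_scale])

lemma ip_commute: "ip D f g = ip D g f"
  by (simp add: ip_def mult.commute)

lemma ip_linear:
  assumes "f \<in> L2 D" "g \<in> L2 D" "h \<in> L2 D"
  shows "ip D (\<lambda>x. a * f x + b * g x) h = a * ip D f h + b * ip D g h"
proof -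
  have "ip D (\<lambda>x. a * f x + b * g x) h =
      (LINT x | lebesgue_on (Omega D). a * (f x * h x) + b * (g x * h x))"
    by (simp add: ip_def algebra_simps)
  also have "\<dots> = a * ip D f h + b * ip D g h"
    unfolding ip_def using assms by (simp add: L2_integrable_mult)
  finally show ?thesis .
qed

lemma ip_zero: "ip D (\<lambda>x. 0) h = 0"
  by (simp add: ip_def)

lemma ip_add: "f \<in> L2 D \<Longrightarrow> g \<in> L2 D \<Longrightarrow> h \<in> L2 D \<Longrightarrow> ip D (\<lambda>x. f x + g x) h = ip D f h + ip D g h"
  using ip_linear[of f g h 1 1] by simp

lemma ip_diff: "f \<in> L2 D \<Longrightarrow> g \<in> L2 D \<Longrightarrow> h \<in> L2 D \<Longrightarrow> ip D (\<lambda>x. f x - g x) h = ip D f h - ip D g h"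
  using ip_linear[of f g h 1 "-1"] by simp

lemma ip_scale: "ip D (\<lambda>x. c * f x) h = c * ip D f h"
  by (simp add: ip_def mult.assoc)

lemma ip_sum:
  assumes "\<And>i. i \<in> I \<Longrightarrow> f i \<in> L2 D" "h \<in> L2 D"
  shows "ip D (\<lambda>x. \<Sum>i\<in>I. c i * f i x) h = (\<Sum>i\<in>I. c i * ip D (f i) h)"
  using assms(1)
proof (induction I rule: infinite_finite_induct)
  case (insert i I)
  then have "ip D (\<lambda>x. c i * f i x + (\<Sum>j\<in>I. c j * f j x)) h =
      ip D (\<lambda>x. c i * f i x) h + ip D (\<lambda>x. \<Sum>j\<in>I. c j * f j x) h"
    using assms(2) by (intro ip_add L2_scale L2_sum) auto
  with insert show ?case by (simp add: ip_scale)
qed (simp_all add: ip_zero)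

lemma ip_cong:
  assumes "f \<in> L2 D" "f' \<in> L2 D" "g \<in> L2 D" "g' \<in> L2 D" "eq_on D f f'" "eq_on D g g'"
  shows "ip D f g = ip D f' g'"
  unfolding ip_def
proof (rule integral_cong_AE)
  show "AE x in lebesgue_on (Omega D). f x * g x = f' x * g' x"
    using assms(5,6) unfolding eq_on_def by eventually_elim simp
  show "(\<lambda>x. f x * g x) \<in> borel_measurable (lebesgue_on (Omega D))"
    "(\<lambda>x. f' x * g' x) \<in> borel_measurable (lebesgue_on (Omega D))"
    using assms by (intro borel_measurable_times L2_measurable; simp)+
qed

lemma ip_nonneg: "0 \<le> ip D f f"
  by (simp add: ip_def)

lemma ip_eq_0:
  assumes "f \<in> L2 D" "ip D f f = 0"
  shows "eq_on D f (\<lambda>x. 0)"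
proof -
  have "AE x in lebesgue_on (Omega D). f x * f x = 0"
    using assms(2) integral_nonneg_eq_0_iff_AE[OF L2_integrable_mult[OF assms(1,1)]]
    by (simp add: ip_def)
  then show ?thesis by (simp add: eq_on_def)
qed

lemma l2norm_power2: "(l2norm D f)\<^sup>2 = ip D f f"
  by (simp add: l2norm_def ip_nonneg)

lemma eq_on_refl: "eq_on D f f"
  by (simp add: eq_on_def)

lemma eq_on_sym: "eq_on D f g \<Longrightarrow> eq_on D g f"
  unfolding eq_on_def by (rule eventually_mono) auto

lemma eq_on_trans [trans]:
  assumes "eq_on D f g" "eq_on D g h"
  shows "eq_on D f h"
  using assms unfolding eq_on_def by eventually_elim simp

lemma eq_on_diff_zero: "eq_on D (\<lambda>x. f x - g x) (\<lambda>x. 0) \<longleftrightarrow> eq_on D f g"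
  by (simp add: eq_on_def)

text \<open>The difference is itself an admissible test function, so its norm is zero.\<close>

lemma Vh_eq_onI:
  assumes "v \<in> Vh D" "w \<in> Vh D" "\<And>\<phi>. \<phi> \<in> Vh D \<Longrightarrow> ip D v \<phi> = ip D w \<phi>"
  shows "eq_on D v w"
proof -
  have d: "(\<lambda>x. v x - w x) \<in> Vh D" using assms by (intro Vh_diff)
  then have "ip D (\<lambda>x. v x - w x) (\<lambda>x. v x - w x) = 0"
    using assms by (simp add: ip_diff Vh_L2)
  with d have "eq_on D (\<lambda>x. v x - w x) (\<lambda>x. 0)" by (intro ip_eq_0 Vh_L2)
  then show ?thesis by (simp only: eq_on_diff_zero)
qed

section \<open>Face integrals, linearity and symmetry of the form G\<close>

lemma face_integrand_integrable:
  fixes f :: "'a \<Rightarrow> real"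
  assumes f: "continuous_on UNIV f" and K: "K1 \<in> mesh D" "K2 \<in> mesh D"
    and face: "is_face (K1 \<inter> (+) l ` K2)"
  shows "integrable (lebesgue_on {x + t *\<^sub>R \<nu> | x t. x \<in> K1 \<inter> (+) l ` K2 \<and> 0 \<le> t \<and> t \<le> 1})
    (\<lambda>y. f (closest_point (K1 \<inter> (+) l ` K2) y))"
proof (rule integrable_continuous_compact)
  let ?e = "K1 \<inter> (+) l ` K2"
  have e: "compact ?e" "convex ?e"
    using K by (auto intro: compact_Int compact_translation convex_Int convex_translation
        compact_mesh convex_mesh)
  \<comment> \<open>The closest point map is continuous for a nonempty closed convex set. A face is
    nonempty because its dimension d - 1 is at least 0, whereas the empty set has affine dimension
    -1.\<close>
  have "?e \<noteq> {}"
  proof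
    assume "?e = {}"
    with face have "- 1 = int DIM('a) - 1" unfolding is_face_def by (simp only: aff_dim_empty_eq)
    then show False by simp
  qed
  with e have "continuous_on S (closest_point ?e)" for S
    by (intro continuous_on_closest_point compact_imp_closed)
  then show "continuous_on S (\<lambda>y. f (closest_point ?e y))" for S
    by (intro continuous_on_compose2[OF f]) auto
  \<comment> \<open>The prism over the face is the continuous image of the compact product of the
    face and [0, 1].\<close>
  have "compact ((\<lambda>(x, t). x + t *\<^sub>R \<nu>) ` (?e \<times> {0..1}))"
    using e(1) by (intro compact_continuous_image compact_Times compact_Icc)
      (auto simp: case_prod_beta intro!: continuous_intros)
  also have "(\<lambda>(x, t). x + t *\<^sub>R \<nu>) ` (e \<times> {0..1}) = {x + t *\<^sub>R \<nu> | x t. x \<in> e \<and> 0 \<le> t \<and> t \<le> 1}"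
    for e by fastforce
  finally show "compact {x + t *\<^sub>R \<nu> | x t. x \<in> ?e \<and> 0 \<le> t \<and> t \<le> 1}" .
qed

lemma continuous_jump:
  assumes "v \<in> Vh D" "K1 \<in> mesh D" "K2 \<in> mesh D"
  shows "continuous_on UNIV (jump D K1 K2 l v)"
proof -
  have "continuous_on UNIV (\<lambda>x. piece D K2 v (x - l))"
    using C1_fun_continuous[OF piece_C1[OF assms(1,3)], of UNIV]
    by (rule continuous_on_compose2) (auto intro: continuous_intros)
  then show ?thesis
    unfolding jump_def[abs_def]
    using C1_fun_continuous[OF piece_C1[OF assms(1,2)]] by (intro continuous_on_diff)
qed

lemma continuous_avg_dn:
  assumes "v \<in> Vh D" "K1 \<in> mesh D" "K2 \<in> mesh D"
  shows "continuous_on UNIV (avg_dn D K1 K2 l \<nu> v)"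
proof -
  have "continuous_on UNIV (\<lambda>x. grad (piece D K2 v) (x - l))"
    using continuous_on_grad[OF piece_C1[OF assms(1,3)], of UNIV]
    by (rule continuous_on_compose2) (auto intro: continuous_intros)
  then show ?thesis
    unfolding avg_dn_def[abs_def]
    using continuous_on_grad[OF piece_C1[OF assms(1,2)]] by (intro continuous_intros) auto
qed

lemma jump_linear:
  assumes "v \<in> Vh D" "w \<in> Vh D" "K1 \<in> mesh D" "K2 \<in> mesh D"
  shows "jump D K1 K2 l (\<lambda>x. a * v x + b * w x) x = a * jump D K1 K2 l v x + b * jump D K1 K2 l w x"
  using assms by (simp add: jump_def piece_linear algebra_simps)

lemma avg_dn_linear:
  assumes "v \<in> Vh D" "w \<in> Vh D" "K1 \<in> mesh D" "K2 \<in> mesh D"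
  shows "avg_dn D K1 K2 l \<nu> (\<lambda>x. a * v x + b * w x) x =
    a * avg_dn D K1 K2 l \<nu> v x + b * avg_dn D K1 K2 l \<nu> w x"
  using assms
  by (simp add: avg_dn_def piece_linear grad_linear piece_C1 inner_add_right algebra_simps add_divide_distrib)

text \<open>The normal is chosen from the two elements alone, so all three face terms use the same
  \<open>\<nu>\<close>. The integrand is then linear in its first function, and continuity of jumps
  and averages gives the integrability needed to split the integral.\<close>

lemma face_term_linear:
  assumes V: "u \<in> Vh D" "v \<in> Vh D" "w \<in> Vh D" and K: "K1 \<in> mesh D" "K2 \<in> mesh D"
    and face: "is_face (K1 \<inter> (+) l ` K2)"
  shows "face_term D K1 K2 l (\<lambda>x. a * u x + b * v x) w =
    a * face_term D K1 K2 l u w + b * face_term D K1 K2 l v w"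
proof -
  define \<nu> where "\<nu> = face_normal K1 ((+) l ` K2)"
  define f where "f u x = avg_dn D K1 K2 l \<nu> u x * jump D K1 K2 l w x
    + jump D K1 K2 l u x * avg_dn D K1 K2 l \<nu> w x" for u x
  have cont: "continuous_on UNIV (f u)" if "u \<in> Vh D" for u
    unfolding f_def[abs_def]
    using that V K by (intro continuous_on_add continuous_on_mult continuous_jump continuous_avg_dn)
  have lin: "f (\<lambda>x. a * u x + b * v x) x = a * f u x + b * f v x" for x
    unfolding f_def using V K by (simp add: jump_linear avg_dn_linear algebra_simps)
  have "face_integral \<nu> (K1 \<inter> (+) l ` K2) (\<lambda>x. a * f u x + b * f v x) =
      a * face_integral \<nu> (K1 \<inter> (+) l ` K2) (f u) + b * face_integral \<nu> (K1 \<inter> (+) l ` K2) (f v)"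
    unfolding face_integral_def
    using face_integrand_integrable[OF cont[OF V(1)] K face] face_integrand_integrable[OF cont[OF V(2)] K face]
    by simp
  then show ?thesis
    unfolding face_term_def \<nu>_def[symmetric] Let_def f_def[symmetric] lin .
qed

lemma face_term_commute: "face_term D K1 K2 l w v = face_term D K1 K2 l v w"
  by (simp add: face_term_def Let_def add.commute mult.commute)

lemma G_commute: "G D w v = G D v w"
  by (simp add: G_def face_term_commute[of _ _ _ w v] inner_commute mult.commute mult.left_commute)

lemma G_linear:
  assumes V: "u \<in> Vh D" "v \<in> Vh D" "w \<in> Vh D"
  shows "G D (\<lambda>x. a * u x + b * v x) w = a * G D u w + b * G D v w"
proof -
  have elt: "(LINT x | lebesgue_on K. grad (piece D K (\<lambda>x. a * u x + b * v x)) x \<bullet> grad (piece D K w) x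
        - apar D * piece D K (\<lambda>x. a * u x + b * v x) x * piece D K w x) =
      a * (LINT x | lebesgue_on K. grad (piece D K u) x \<bullet> grad (piece D K w) x
        - apar D * piece D K u x * piece D K w x) +
      b * (LINT x | lebesgue_on K. grad (piece D K v) x \<bullet> grad (piece D K w) x
        - apar D * piece D K v x * piece D K w x)" if K: "K \<in> mesh D" for K
  proof -
    have int: "integrable (lebesgue_on K) (\<lambda>x. grad (piece D K u) x \<bullet> grad (piece D K w) x
        - apar D * piece D K u x * piece D K w x)" if "u \<in> Vh D" for u
      using that K V
      by (intro integrable_continuous_compact compact_mesh continuous_intros continuous_on_grad
          C1_fun_continuous piece_C1)
    have "grad (piece D K (\<lambda>x. a * u x + b * v x)) x \<bullet> grad (piece D K w) x
        - apar D * piece D K (\<lambda>x. a * u x + b * v x) x * piece D K w x =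
      a * (grad (piece D K u) x \<bullet> grad (piece D K w) x - apar D * piece D K u x * piece D K w x) +
      b * (grad (piece D K v) x \<bullet> grad (piece D K w) x - apar D * piece D K v x * piece D K w x)" for x
      using V K by (simp add: piece_linear grad_linear piece_C1 inner_add_left algebra_simps)
    then show ?thesis using int[OF V(1)] int[OF V(2)] by simp
  qed
  have int: "face_term D K1 K2 0 (\<lambda>x. a * u x + b * v x) w =
      a * face_term D K1 K2 0 u w + b * face_term D K1 K2 0 v w" if "(K1, K2) \<in> interfaces D" for K1 K2
    using interfaces_face[OF that] by (intro face_term_linear V) simp_all
  have bdry: "face_term D K1 K2 l (\<lambda>x. a * u x + b * v x) w =
      a * face_term D K1 K2 l u w + b * face_term D K1 K2 l v w" if "(K1, K2, l) \<in> boundary_faces D" for K1 K2 l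
    using that by (intro face_term_linear V) (simp_all add: boundary_faces_def)
  have "(\<Sum>(K1, K2)\<in>interfaces D. face_term D K1 K2 0 (\<lambda>x. a * u x + b * v x) w) =
      a * (\<Sum>(K1, K2)\<in>interfaces D. face_term D K1 K2 0 u w) +
      b * (\<Sum>(K1, K2)\<in>interfaces D. face_term D K1 K2 0 v w)"
    unfolding sum_distrib_left sum.distrib[symmetric]
    by (intro sum.cong refl) (auto simp: int)
  \<comment> \<open>A sum over an infinite index set is 0 by convention, so
    \<open>sum.distrib\<close> applies without deciding whether \<open>boundary_faces D\<close> is
    finite.\<close>
  moreover have "(\<Sum>(K1, K2, l)\<in>boundary_faces D. face_term D K1 K2 l (\<lambda>x. a * u x + b * v x) w) =
      a * (\<Sum>(K1, K2, l)\<in>boundary_faces D. face_term D K1 K2 l u w) +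
      b * (\<Sum>(K1, K2, l)\<in>boundary_faces D. face_term D K1 K2 l v w)"
    unfolding sum_distrib_left sum.distrib[symmetric]
    by (intro sum.cong refl) (auto simp: bdry)
  moreover have "(\<Sum>K\<in>mesh D. LINT x | lebesgue_on K.
        grad (piece D K (\<lambda>x. a * u x + b * v x)) x \<bullet> grad (piece D K w) x
        - apar D * piece D K (\<lambda>x. a * u x + b * v x) x * piece D K w x) =
      a * (\<Sum>K\<in>mesh D. LINT x | lebesgue_on K. grad (piece D K u) x \<bullet> grad (piece D K w) x
        - apar D * piece D K u x * piece D K w x) +
      b * (\<Sum>K\<in>mesh D. LINT x | lebesgue_on K. grad (piece D K v) x \<bullet> grad (piece D K w) x
        - apar D * piece D K v x * piece D K w x)"
    unfolding sum_distrib_left sum.distrib[symmetric] by (intro sum.cong refl elt)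
  moreover have "(a * x + b * y) + (a * x' + b * y') + c * (a * x'' + b * y'') =
      a * (x + x' + c * x'') + b * (y + y' + c * y'')" for x y x' y' x'' y'' c :: real
    by (simp add: algebra_simps)
  ultimately show ?thesis unfolding G_def by (simp only:)
qed

text \<open>\<open>G\<close> sees its arguments only through their polynomial pieces, including all
  traces on faces, and the pieces depend only on the class modulo null sets.\<close>

lemma G_cong:
  assumes "v \<in> Vh D" "eq_on D u v"
  shows "G D u w = G D v w"
proof -
  have p: "piece D K u = piece D K v" if "K \<in> mesh D" for K using assms that by (intro piece_cong)
  have ft: "face_term D K1 K2 l u w = face_term D K1 K2 l v w" if "K1 \<in> mesh D" "K2 \<in> mesh D" for K1 K2 l
    using that by (simp add: face_term_def avg_dn_def jump_def p)
  have "(\<Sum>(K1, K2)\<in>interfaces D. face_term D K1 K2 0 u w) = (\<Sum>(K1, K2)\<in>interfaces D. face_term D K1 K2 0 v w)"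
    by (intro sum.cong refl) (auto dest!: interfaces_face intro!: ft)
  moreover have "(\<Sum>(K1, K2, l)\<in>boundary_faces D. face_term D K1 K2 l u w) =
      (\<Sum>(K1, K2, l)\<in>boundary_faces D. face_term D K1 K2 l v w)"
    by (intro sum.cong refl) (auto simp: boundary_faces_def intro!: ft)
  ultimately show ?thesis unfolding G_def by (simp add: p)
qed

section \<open>Orthonormal bases and the operators they provide\<close>

lemma L2_bounded_mult:
  assumes h: "h \<in> borel_measurable (lebesgue_on (Omega D))"
    "AE x in lebesgue_on (Omega D). \<bar>h x\<bar> \<le> B" and f: "f \<in> L2 D"
  shows "(\<lambda>x. h x * f x) \<in> L2 D"
proof -
  have meas: "(\<lambda>x. h x * f x) \<in> borel_measurable (lebesgue_on (Omega D))"
    using h(1) L2_measurable[OF f] by (rule borel_measurable_times)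
  have "integrable (lebesgue_on (Omega D)) (\<lambda>x. (h x * f x)\<^sup>2)"
  proof (rule Bochner_Integration.integrable_bound)
    show "integrable (lebesgue_on (Omega D)) (\<lambda>x. B\<^sup>2 * (f x)\<^sup>2)"
      using L2_integrable_square[OF f] by simp
    show "(\<lambda>x. (h x * f x)\<^sup>2) \<in> borel_measurable (lebesgue_on (Omega D))"
      using meas by (rule borel_measurable_power)
    have "(a * c)\<^sup>2 \<le> B\<^sup>2 * c\<^sup>2" if "\<bar>a\<bar> \<le> B" for a c
    proof -
      from that have "\<bar>a\<bar> \<le> \<bar>B\<bar>" by linarith
      then have "a\<^sup>2 \<le> B\<^sup>2" by (simp only: abs_le_square_iff)
      then show ?thesis by (simp add: power_mult_distrib mult_right_mono)
    qed
    then show "AE x in lebesgue_on (Omega D). norm ((h x * f x)\<^sup>2) \<le> norm (B\<^sup>2 * (f x)\<^sup>2)"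
      using h(2) by (auto elim!: eventually_mono)
  qed
  with meas show ?thesis by (simp add: L2_def)
qed

lemma L2_const: "(\<lambda>x. c) \<in> L2 D"
proof -
  interpret finite_measure "lebesgue_on (Omega D)"
    by (rule finite_measure_lebesgue_on[OF lmeasurable_Omega])
  show ?thesis by (simp add: L2_def)
qed

lemma L2_bounded:
  assumes "h \<in> borel_measurable (lebesgue_on (Omega D))" "AE x in lebesgue_on (Omega D). \<bar>h x\<bar> \<le> B"
  shows "h \<in> L2 D"
  using L2_bounded_mult[OF assms L2_const[of 1]] by simp

text \<open>Since the interiors are disjoint, a common point lies on one of the two frontiers, and
  frontiers of convex sets are negligible.\<close>

lemma mesh_overlap:
  assumes "K \<in> mesh D" "K' \<in> mesh D" "K \<noteq> K'"
  shows "AE x in lebesgue_on K'. x \<notin> K"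
proof -
  have "K \<inter> K' \<subseteq> frontier K \<union> frontier K'"
    using interior_mesh_disjoint[OF assms] closure_subset[of K] closure_subset[of K']
    unfolding frontier_def by blast
  moreover have "negligible (frontier K \<union> frontier K')"
    using assms by (intro negligible_Un negligible_convex_frontier convex_mesh)
  ultimately have "negligible (K \<inter> K')" by (rule negligible_subset[rotated])
  then have "AE x in lebesgue. x \<notin> K \<inter> K'"
    by (intro AE_not_in) (simp add: negligible_iff_null_sets)
  then have "AE x in lebesgue. x \<in> K' \<longrightarrow> x \<notin> K" by (rule eventually_mono) auto
  then show ?thesis using sets_mesh[OF assms(2)] by (subst AE_restrict_space_iff) simp_all
qed

text \<open>\<open>indicator K\<close> is also 1 on the part of the frontier shared with a
  neighbour, so on another element the product is the zero polynomial only up to the null set of the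
  overlap.\<close>

lemma indicator_monomial_Vh:
  assumes K: "K \<in> mesh D" and \<alpha>: "\<alpha> \<in> multi_indices (degr D)"
  shows "(\<lambda>x. indicator K x * monomial \<alpha> x) \<in> Vh D"
  unfolding Vh_def
proof (intro CollectI conjI ballI)
  have cont: "continuous_on S (monomial \<alpha>)" for S
    using monomial_in_poly_space[OF \<alpha>] by (intro C1_fun_continuous poly_space_C1)
  from compact_imp_bounded[OF compact_continuous_image[OF cont compact_mesh[OF K]]]
  obtain B where B: "\<forall>x\<in>K. \<bar>monomial \<alpha> x\<bar> \<le> B" unfolding bounded_iff by auto
  show "(\<lambda>x. indicator K x * monomial \<alpha> x) \<in> L2 D"
  proof (rule L2_bounded)
    have "indicator K \<in> borel_measurable (lebesgue_on (Omega D))"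
      using sets_mesh[OF K] by (intro measurable_restrict_space1 borel_measurable_indicator)
    then show "(\<lambda>x. indicator K x * monomial \<alpha> x) \<in> borel_measurable (lebesgue_on (Omega D))"
      using continuous_imp_measurable_on_sets_lebesgue[OF cont sets_Omega]
      by (rule borel_measurable_times)
    \<comment> \<open>The maximum with 0 covers the points outside \<open>K\<close>, where the
      product is 0.\<close>
    show "AE x in lebesgue_on (Omega D). \<bar>indicator K x * monomial \<alpha> x\<bar> \<le> max B 0"
      using B by (intro AE_I2) (auto simp: indicator_def le_max_iff_disj)
  qed
  fix K' assume K': "K' \<in> mesh D"
  show "\<exists>p\<in>poly_space (degr D). AE x in lebesgue_on K'. indicator K x * monomial \<alpha> x = p x"
  proof (cases "K' = K")
    case True
    have "AE x in lebesgue_on K. indicator K x * monomial \<alpha> x = monomial \<alpha> x"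
      by (rule AE_I2) (simp add: space_restrict_space)
    with True monomial_in_poly_space[OF \<alpha>] show ?thesis by blast
  next
    case False
    with mesh_overlap[OF K K'] have "AE x in lebesgue_on K'. indicator K x * monomial \<alpha> x = 0"
      by (auto elim!: eventually_mono)
    then show ?thesis by (rule bexI[OF _ zero_in_poly_space])
  qed
qed

text \<open>Almost every point of an element lies in no other element. There the double sum
  collapses to the expansion of the single polynomial piece.\<close>

lemma Vh_expand:
  assumes v: "v \<in> Vh D"
  shows "\<exists>c. eq_on D v (\<lambda>x. \<Sum>(K, \<alpha>)\<in>mesh D \<times> multi_indices (degr D).
    c K \<alpha> * (indicator K x * monomial \<alpha> x))"
proof -
  have "\<forall>K\<in>mesh D. \<exists>c. piece D K v = (\<lambda>x. \<Sum>\<alpha>\<in>multi_indices (degr D). c \<alpha> * monomial \<alpha> x)"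
    using Vh_piece(1)[OF v] by (simp add: poly_space_iff)
  from bchoice[OF this] obtain c
    where c: "\<And>K. K \<in> mesh D \<Longrightarrow> piece D K v = (\<lambda>x. \<Sum>\<alpha>\<in>multi_indices (degr D). c K \<alpha> * monomial \<alpha> x)"
    by blast
  have "AE x in lebesgue_on K'. v x = (\<Sum>(K, \<alpha>)\<in>mesh D \<times> multi_indices (degr D).
    c K \<alpha> * (indicator K x * monomial \<alpha> x))" if K': "K' \<in> mesh D" for K'
  proof -
    have "AE x in lebesgue_on K'. \<forall>K\<in>mesh D. K \<noteq> K' \<longrightarrow> x \<notin> K"
      using mesh_overlap[OF _ K'] finite_mesh by (subst AE_ball_countable) (auto simp: countable_finite)
    moreover have "AE x in lebesgue_on K'. x \<in> K'" by (rule AE_I2) (simp add: space_restrict_space)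
    ultimately show ?thesis using Vh_piece(2)[OF v K']
    proof eventually_elim
      case (elim x)
      have "(\<Sum>(K, \<alpha>)\<in>mesh D \<times> multi_indices (degr D). c K \<alpha> * (indicator K x * monomial \<alpha> x)) =
          (\<Sum>K\<in>mesh D. if K = K' then \<Sum>\<alpha>\<in>multi_indices (degr D). c K' \<alpha> * monomial \<alpha> x else 0)"
        unfolding sum.cartesian_product[symmetric]
        using elim(1,2) by (intro sum.cong refl) auto
      also have "\<dots> = v x" using elim(3) K' finite_mesh by (simp add: c[OF K'])
      finally show ?case by simp
    qed
  qed
  then have "eq_on D v (\<lambda>x. \<Sum>(K, \<alpha>)\<in>mesh D \<times> multi_indices (degr D).
    c K \<alpha> * (indicator K x * monomial \<alpha> x))"
    by (simp add: eq_on_def AE_Omega_iff)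
  then show ?thesis by (rule exI[of _ c])
qed

section \<open>Orthonormal bases\<close>

definition orthonormal :: "('a \<Rightarrow> real) set \<Rightarrow> bool" where
  "orthonormal B \<longleftrightarrow> finite B \<and> B \<subseteq> Vh D \<and> (\<forall>e\<in>B. \<forall>f\<in>B. ip D e f = (if e = f then 1 else 0))"

text \<open>For orthonormal \<open>B\<close> this is the orthogonal projection onto the span of
  \<open>B\<close>.\<close>

definition component :: "('a \<Rightarrow> real) set \<Rightarrow> ('a \<Rightarrow> real) \<Rightarrow> 'a \<Rightarrow> real" where
  "component B v = (\<lambda>x. \<Sum>e\<in>B. ip D v e * e x)"

lemma component_Vh: "orthonormal B \<Longrightarrow> component B v \<in> Vh D"
  unfolding component_def orthonormal_def by (intro Vh_sum) blast

lemma ip_orthonormal_sum: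
  assumes B: "orthonormal B" and f: "f \<in> B"
  shows "ip D (\<lambda>x. \<Sum>e\<in>B. c e * e x) f = c f"
proof -
  from B have BV: "e \<in> L2 D" if "e \<in> B" for e using that Vh_L2 by (auto simp: orthonormal_def)
  have "ip D (\<lambda>x. \<Sum>e\<in>B. c e * e x) f = (\<Sum>e\<in>B. c e * ip D e f)"
    using BV f by (intro ip_sum)
  also have "\<dots> = (\<Sum>e\<in>B. if e = f then c f else 0)"
    using B f by (intro sum.cong refl) (auto simp: orthonormal_def)
  also have "\<dots> = c f" using B f by (simp add: orthonormal_def)
  finally show ?thesis .
qed

text \<open>The residual of \<open>v\<close> against the projection is either null, and then nothing
  is added, or it is normalized and added to the basis. The null case yields equality only almost
  everywhere, so the spanning property is carried along in that form.\<close>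

lemma gram_schmidt:
  assumes "finite S" "S \<subseteq> Vh D"
  shows "\<exists>B. orthonormal B \<and> (\<forall>v\<in>S. eq_on D v (component B v))"
  using assms
proof (induction S rule: finite_induct)
  case empty
  show ?case by (intro exI[of _ "{}"]) (simp add: orthonormal_def)
next
  case (insert v S)
  then obtain B where B: "orthonormal B" and S: "\<And>w. w \<in> S \<Longrightarrow> eq_on D w (component B w)" by auto
  have BV: "e \<in> Vh D" if "e \<in> B" for e using that B by (auto simp: orthonormal_def)
  have v: "v \<in> Vh D" using insert.prems by simp
  define r where "r = (\<lambda>x. v x - component B v x)"
  have r: "r \<in> Vh D" unfolding r_def using v component_Vh[OF B] by (rule Vh_diff)
  have r_orth: "ip D r e = 0" if "e \<in> B" for e
    unfolding r_def using that BV v component_Vh[OF B]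
    by (simp add: ip_diff Vh_L2) (simp add: component_def ip_orthonormal_sum[OF B])
  show ?case
  proof (cases "ip D r r = 0")
    case True
    with r have "eq_on D r (\<lambda>x. 0)" by (intro ip_eq_0 Vh_L2)
    then have "eq_on D v (component B v)" by (simp only: r_def eq_on_diff_zero)
    with B S show ?thesis by auto
  next
    case False
    with ip_nonneg[of r] have pos: "0 < ip D r r" by linarith
    define e where "e = (\<lambda>x. 1 / sqrt (ip D r r) * r x)"
    have e: "e \<in> Vh D" unfolding e_def using r by (rule Vh_scale)
    have re: "ip D r e = sqrt (ip D r r)"
    proof -
      have "ip D r e = 1 / sqrt (ip D r r) * ip D r r"
        unfolding ip_commute[of r e] by (simp only: e_def ip_scale)
      then show ?thesis using pos by (simp add: real_div_sqrt)
    qed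
    have ee: "ip D e e = 1"
    proof -
      have "ip D e e = 1 / sqrt (ip D r r) * ip D r e" unfolding e_def by (rule ip_scale)
      with re pos show ?thesis by simp
    qed
    have ef: "ip D e f = 0" if "f \<in> B" for f
      unfolding e_def ip_scale using r_orth[OF that] by simp
    have fe: "ip D f e = 0" if "f \<in> B" for f
      using ef[OF that] by (simp only: ip_commute[of f e])
    have eB: "e \<notin> B"
    proof
      assume "e \<in> B"
      from ef[OF this] ee show False by simp
    qed
    have "orthonormal (insert e B)"
      using B e eB ee ef fe by (auto simp: orthonormal_def)
    \<comment> \<open>An earlier \<open>w\<close> agrees almost everywhere with a combination of
      \<open>B\<close>, to which \<open>e\<close> is orthogonal. Its new coefficient is therefore 0
      and its projection is unchanged.\<close>
    moreover have "eq_on D w (component (insert e B) w)" if "w \<in> S" for w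
    proof -
      have "ip D w e = ip D (component B w) e"
        using S[OF that] insert.prems that e component_Vh[OF B]
        by (intro ip_cong eq_on_refl) (auto intro: Vh_L2)
      also have "\<dots> = (\<Sum>f\<in>B. ip D w f * ip D f e)"
        unfolding component_def using BV e by (intro ip_sum) (auto intro: Vh_L2)
      also have "\<dots> = 0" using fe by (intro sum.neutral) simp
      finally have "component (insert e B) w = component B w"
        using B eB by (simp add: component_def orthonormal_def)
      with S[OF that] show ?thesis by simp
    qed
    \<comment> \<open>The projection of \<open>v\<close> onto the old basis is orthogonal to
      \<open>e\<close>, so the new coefficient is that of the residual,
      \<open>sqrt (ip D r r)\<close>. Multiplied by \<open>e\<close> it restores exactly the
      residual.\<close>
    moreover have "component (insert e B) v = v"
    proof
      fix x
      have "v = (\<lambda>x. r x + component B v x)" by (simp add: r_def)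
      then have "ip D v e = ip D (\<lambda>x. r x + component B v x) e" by simp
      also have "\<dots> = ip D r e + ip D (component B v) e"
        using r e component_Vh[OF B] by (intro ip_add Vh_L2)
      also have "ip D (component B v) e = (\<Sum>f\<in>B. ip D v f * ip D f e)"
        unfolding component_def using BV e by (intro ip_sum) (auto intro: Vh_L2)
      also have "\<dots> = 0" using fe by (intro sum.neutral) simp
      also note re
      finally have "component (insert e B) v x = sqrt (ip D r r) * e x + component B v x"
        using B eB by (simp add: component_def orthonormal_def)
      also have "sqrt (ip D r r) * e x = r x" using pos by (simp add: e_def)
      finally show "component (insert e B) v x = v x" by (simp add: r_def)
    qed
    ultimately show ?thesis using eq_on_refl[of v] by (intro exI[of _ "insert e B"]) auto
  qed
qed

text \<open>The residual of \<open>v\<close> is orthogonal to \<open>B\<close>, hence to every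
  function of the spanning family, hence to itself, since it can be expanded in that family.\<close>

lemma orthonormal_basis:
  obtains B where "orthonormal B" "\<And>v. v \<in> Vh D \<Longrightarrow> eq_on D v (component B v)"
proof -
  define f :: "'a set \<times> ('a \<Rightarrow> nat) \<Rightarrow> 'a \<Rightarrow> real"
    where "f = (\<lambda>(K, \<alpha>) x. indicator K x * monomial \<alpha> x)"
  let ?I = "mesh D \<times> multi_indices (degr D)"
  have fV: "f i \<in> Vh D" if "i \<in> ?I" for i
    using that indicator_monomial_Vh by (auto simp: f_def)
  have "finite (f ` ?I)" by (intro finite_imageI finite_cartesian_product finite_mesh finite_multi_indices)
  moreover have "f ` ?I \<subseteq> Vh D" using fV by (rule image_subsetI)
  ultimately obtain B where B: "orthonormal B" "\<And>w. w \<in> f ` ?I \<Longrightarrow> eq_on D w (component B w)"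
    using gram_schmidt[of "f ` ?I"] by blast
  have "eq_on D v (component B v)" if v: "v \<in> Vh D" for v
  proof -
    have BV: "e \<in> Vh D" if "e \<in> B" for e using that B by (auto simp: orthonormal_def)
    define r where "r = (\<lambda>x. v x - component B v x)"
    have r: "r \<in> Vh D" unfolding r_def using v component_Vh[OF B(1)] by (rule Vh_diff)
    have r_orth: "ip D e r = 0" if "e \<in> B" for e
      unfolding ip_commute[of e] r_def using that BV v component_Vh[OF B(1)]
      by (simp add: ip_diff Vh_L2) (simp add: component_def ip_orthonormal_sum[OF B(1)])
    have f_orth: "ip D (f i) r = 0" if "i \<in> ?I" for i
    proof -
      have "ip D (f i) r = ip D (component B (f i)) r"
        using B(2)[of "f i"] that fV[OF that] r component_Vh[OF B(1)]
        by (intro ip_cong eq_on_refl Vh_L2) auto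
      also have "\<dots> = (\<Sum>e\<in>B. ip D (f i) e * ip D e r)"
        unfolding component_def using BV r by (intro ip_sum Vh_L2)
      also have "\<dots> = 0" using r_orth by simp
      finally show ?thesis .
    qed
    from Vh_expand[OF r] obtain c where c: "eq_on D r (\<lambda>x. \<Sum>i\<in>?I. c (fst i) (snd i) * f i x)"
      unfolding f_def case_prod_beta by blast
    have "ip D r r = ip D (\<lambda>x. \<Sum>i\<in>?I. c (fst i) (snd i) * f i x) r"
      using c r fV by (intro ip_cong eq_on_refl Vh_L2 Vh_sum)
    also have "\<dots> = (\<Sum>i\<in>?I. c (fst i) (snd i) * ip D (f i) r)"
      using fV r by (intro ip_sum Vh_L2)
    also have "\<dots> = 0" using f_orth by (intro sum.neutral) simp
    finally have "eq_on D r (\<lambda>x. 0)" using r by (intro ip_eq_0 Vh_L2)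
    then show ?thesis by (simp only: r_def eq_on_diff_zero)
  qed
  then show thesis by (rule that[OF B(1)])
qed

section \<open>Linear functionals, Riesz representation, \<open>Lh\<close> and
  \<open>L2proj\<close>\<close>

definition Vh_functional :: "(('a \<Rightarrow> real) \<Rightarrow> real) \<Rightarrow> bool" where
  "Vh_functional F \<longleftrightarrow>
     (\<forall>v\<in>Vh D. \<forall>w\<in>Vh D. \<forall>a b. F (\<lambda>x. a * v x + b * w x) = a * F v + b * F w) \<and>
     (\<forall>v\<in>Vh D. \<forall>w\<in>Vh D. eq_on D v w \<longrightarrow> F v = F w)"

lemma Vh_functional_linear:
  "Vh_functional F \<Longrightarrow> v \<in> Vh D \<Longrightarrow> w \<in> Vh D \<Longrightarrow>
    F (\<lambda>x. a * v x + b * w x) = a * F v + b * F w"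
  by (simp add: Vh_functional_def)

lemma Vh_functional_cong:
  "Vh_functional F \<Longrightarrow> v \<in> Vh D \<Longrightarrow> w \<in> Vh D \<Longrightarrow> eq_on D v w \<Longrightarrow> F v = F w"
  by (simp add: Vh_functional_def)

lemma Vh_functional_sum:
  assumes F: "Vh_functional F" and v: "\<And>i. i \<in> I \<Longrightarrow> v i \<in> Vh D"
  shows "F (\<lambda>x. \<Sum>i\<in>I. c i * v i x) = (\<Sum>i\<in>I. c i * F (v i))"
proof -
  have zero: "F (\<lambda>x. 0) = 0"
    using Vh_functional_linear[OF F Vh_zero Vh_zero, of 0 0] by simp
  show ?thesis
    using v
  proof (induction I rule: infinite_finite_induct)
    case (insert i I)
    then have "F (\<lambda>x. c i * v i x + 1 * (\<Sum>j\<in>I. c j * v j x)) =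
        c i * F (v i) + 1 * F (\<lambda>x. \<Sum>j\<in>I. c j * v j x)"
      by (intro Vh_functional_linear[OF F] Vh_sum) simp_all
    with insert show ?case by simp
  qed (simp_all add: zero)
qed

text \<open>The expansion of \<open>v\<close> in the basis holds only almost everywhere. This is why
  invariance under \<open>eq_on\<close> is part of \<open>Vh_functional\<close>.\<close>

lemma Vh_functional_eq:
  assumes B: "orthonormal B" "\<And>v. v \<in> Vh D \<Longrightarrow> eq_on D v (component B v)"
    and F: "Vh_functional F" and v: "v \<in> Vh D"
  shows "F v = (\<Sum>e\<in>B. ip D v e * F e)"
proof -
  have "F v = F (component B v)"
    by (rule Vh_functional_cong[OF F v component_Vh[OF B(1)] B(2)[OF v]])
  also have "\<dots> = (\<Sum>e\<in>B. ip D v e * F e)"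
    unfolding component_def using B(1) by (intro Vh_functional_sum[OF F]) (auto simp: orthonormal_def)
  finally show ?thesis .
qed

text \<open>The representing function has the coefficients \<open>F e\<close> in an orthonormal
  basis. It supplies the existence that gives meaning to the choices in \<open>Lh\<close> and
  \<open>L2proj\<close>.\<close>

lemma riesz_Vh:
  assumes F: "Vh_functional F"
  shows "\<exists>w. w \<in> Vh D \<and> (\<forall>\<phi>\<in>Vh D. ip D w \<phi> = F \<phi>)"
proof -
  obtain B where B: "orthonormal B" "\<And>v. v \<in> Vh D \<Longrightarrow> eq_on D v (component B v)"
    by (rule orthonormal_basis) blast
  then have BV: "e \<in> Vh D" if "e \<in> B" for e using that by (auto simp: orthonormal_def)
  have "ip D (\<lambda>x. \<Sum>e\<in>B. F e * e x) \<phi> = F \<phi>" if "\<phi> \<in> Vh D" for \<phi>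
  proof -
    have "ip D (\<lambda>x. \<Sum>e\<in>B. F e * e x) \<phi> = (\<Sum>e\<in>B. F e * ip D e \<phi>)"
      using BV that by (intro ip_sum Vh_L2)
    also have "\<dots> = (\<Sum>e\<in>B. ip D \<phi> e * F e)"
      by (intro sum.cong refl) (simp only: ip_commute mult.commute)
    also have "\<dots> = F \<phi>" using Vh_functional_eq[OF B F that] by simp
    finally show ?thesis .
  qed
  moreover have "(\<lambda>x. \<Sum>e\<in>B. F e * e x) \<in> Vh D" using BV by (rule Vh_sum)
  ultimately show ?thesis by blast
qed

lemma Vh_functional_ip:
  assumes f: "f \<in> L2 D"
  shows "Vh_functional (ip D f)"
  unfolding Vh_functional_def
proof (intro conjI ballI allI impI)
  fix v w assume vw: "v \<in> Vh D" "w \<in> Vh D"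
  show "ip D f (\<lambda>x. a * v x + b * w x) = a * ip D f v + b * ip D f w" for a b
    unfolding ip_commute[of f] using vw f by (simp add: ip_linear Vh_L2)
  show "ip D f v = ip D f w" if "eq_on D v w"
    using vw f that by (intro ip_cong eq_on_refl) (simp_all add: Vh_L2)
qed

lemma Vh_functional_G:
  assumes u: "u \<in> Vh D"
  shows "Vh_functional (G D u)"
  unfolding Vh_functional_def
proof (intro conjI ballI allI impI)
  fix v w assume vw: "v \<in> Vh D" "w \<in> Vh D"
  show "G D u (\<lambda>x. a * v x + b * w x) = a * G D u v + b * G D u w" for a b
    unfolding G_commute[of u] using vw u by (intro G_linear)
  show "G D u v = G D u w" if "eq_on D v w"
    unfolding G_commute[of u] using vw that by (intro G_cong)
qed

lemma Vh_functional_add: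
  "Vh_functional F \<Longrightarrow> Vh_functional F' \<Longrightarrow> Vh_functional (\<lambda>v. F v + F' v)"
  by (simp add: Vh_functional_def algebra_simps)

lemma Lh_props:
  assumes "v \<in> Vh D"
  shows "Lh D v \<in> Vh D \<and> (\<forall>\<phi>\<in>Vh D. ip D (Lh D v) \<phi> = G D v \<phi>)"
  unfolding Lh_def by (rule someI_ex[OF riesz_Vh[OF Vh_functional_G[OF assms]]])

lemma Lh_Vh: "v \<in> Vh D \<Longrightarrow> Lh D v \<in> Vh D"
  and ip_Lh: "v \<in> Vh D \<Longrightarrow> \<phi> \<in> Vh D \<Longrightarrow> ip D (Lh D v) \<phi> = G D v \<phi>"
  using Lh_props by blast+

lemma L2proj_props:
  assumes "f \<in> L2 D"
  shows "L2proj D f \<in> Vh D \<and> (\<forall>\<phi>\<in>Vh D. ip D (L2proj D f) \<phi> = ip D f \<phi>)"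
  unfolding L2proj_def by (rule someI_ex[OF riesz_Vh[OF Vh_functional_ip[OF assms]]])

lemma L2proj_Vh: "f \<in> L2 D \<Longrightarrow> L2proj D f \<in> Vh D"
  and ip_L2proj: "f \<in> L2 D \<Longrightarrow> \<phi> \<in> Vh D \<Longrightarrow> ip D (L2proj D f) \<phi> = ip D f \<phi>"
  using L2proj_props by blast+

lemma Lh_cong:
  assumes "v \<in> Vh D" "w \<in> Vh D" "eq_on D v w"
  shows "eq_on D (Lh D v) (Lh D w)"
  using assms by (intro Vh_eq_onI Lh_Vh) (simp_all add: ip_Lh G_cong[of w v])

lemma L2proj_cong:
  assumes "f \<in> L2 D" "g \<in> L2 D" "eq_on D f g"
  shows "eq_on D (L2proj D f) (L2proj D g)"
proof (intro Vh_eq_onI L2proj_Vh assms)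
  fix \<phi> assume \<phi>: "\<phi> \<in> Vh D"
  then have "ip D f \<phi> = ip D g \<phi>" using assms by (intro ip_cong eq_on_refl) (simp_all add: Vh_L2)
  with \<phi> assms show "ip D (L2proj D f) \<phi> = ip D (L2proj D g) \<phi>" by (simp add: ip_L2proj)
qed

text \<open>For \<open>w\<close> a representative of the projection, testing with \<open>w\<close>
  gives <w, w> = <f, w>. Hence the squared norm of f - w is <f, f> - <w, w>, which is
  nonnegative.\<close>

lemma ip_L2proj_le:
  assumes f: "f \<in> L2 D" and w: "w \<in> Vh D" "eq_on D w (L2proj D f)"
  shows "ip D w w \<le> ip D f f"
proof -
  have P: "L2proj D f \<in> L2 D" using Vh_L2[OF L2proj_Vh[OF f]] .
  have w': "w \<in> L2 D" using w(1) by (rule Vh_L2)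
  have ww: "ip D w w = ip D f w"
    using ip_cong[OF w' P w' w' w(2) eq_on_refl] ip_L2proj[OF f w(1)] by simp
  have d: "(\<lambda>x. f x - w x) \<in> L2 D" using f w' by (rule L2_diff)
  have "0 \<le> ip D (\<lambda>x. f x - w x) (\<lambda>x. f x - w x)" by (rule ip_nonneg)
  also have "\<dots> = ip D (\<lambda>x. f x - w x) f - ip D (\<lambda>x. f x - w x) w"
    unfolding ip_diff[OF f w' d] ip_commute[of f] ip_commute[of w] ..
  also have "\<dots> = ip D f f - ip D w w"
    unfolding ip_diff[OF f w' f] ip_diff[OF f w' w'] ip_commute[of w f] using ww by simp
  finally show ?thesis by simp
qed

section \<open>Bounded coefficients\<close>

lemma Vh_AE_bounded:
  assumes v: "v \<in> Vh D"
  shows "\<exists>B. AE x in lebesgue_on (Omega D). \<bar>v x\<bar> \<le> B"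
proof -
  have "\<forall>K\<in>mesh D. \<exists>B. \<forall>x\<in>K. \<bar>piece D K v x\<bar> \<le> B"
  proof
    fix K assume K: "K \<in> mesh D"
    from compact_imp_bounded[OF compact_continuous_image[OF C1_fun_continuous[OF piece_C1[OF v K]] compact_mesh[OF K]]]
    show "\<exists>B. \<forall>x\<in>K. \<bar>piece D K v x\<bar> \<le> B" unfolding bounded_iff by auto
  qed
  from bchoice[OF this] obtain B where B: "\<And>K x. K \<in> mesh D \<Longrightarrow> x \<in> K \<Longrightarrow> \<bar>piece D K v x\<bar> \<le> B K"
    by blast
  \<comment> \<open>The sum of the bounds on the finitely many elements serves as one bound for all
    of them.\<close>
  have "AE x in lebesgue_on K. \<bar>v x\<bar> \<le> (\<Sum>K\<in>mesh D. \<bar>B K\<bar>)" if K: "K \<in> mesh D" for K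
  proof -
    have "AE x in lebesgue_on K. x \<in> K" by (rule AE_I2) (simp add: space_restrict_space)
    with Vh_piece(2)[OF v K] show ?thesis
    proof eventually_elim
      case (elim x)
      then have "\<bar>v x\<bar> \<le> \<bar>B K\<bar>" using B[OF K, of x] by simp
      also have "\<dots> \<le> (\<Sum>K\<in>mesh D. \<bar>B K\<bar>)" using finite_mesh K by (intro member_le_sum) auto
      finally show ?case .
    qed
  qed
  then show ?thesis by (auto simp: AE_Omega_iff)
qed

lemma continuous_comp_Vh:
  assumes v: "v \<in> Vh D" and g: "continuous_on UNIV g"
  shows "(\<lambda>x. g (v x)) \<in> borel_measurable (lebesgue_on (Omega D))"
    and "\<exists>B. AE x in lebesgue_on (Omega D). \<bar>g (v x) :: real\<bar> \<le> B"
proof -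
  show "(\<lambda>x. g (v x)) \<in> borel_measurable (lebesgue_on (Omega D))"
    using borel_measurable_continuous_onI[OF g] L2_measurable[OF Vh_L2[OF v]]
    by (rule measurable_compose_rev)
  from Vh_AE_bounded[OF v] obtain B where B: "AE x in lebesgue_on (Omega D). \<bar>v x\<bar> \<le> B" ..
  have "compact (g ` {-B..B})"
    using g by (intro compact_continuous_image compact_Icc) (rule continuous_on_subset, auto)
  from compact_imp_bounded[OF this] obtain C where C: "\<forall>y\<in>{-B..B}. \<bar>g y\<bar> \<le> C"
    unfolding bounded_iff by auto
  have "AE x in lebesgue_on (Omega D). \<bar>g (v x)\<bar> \<le> C"
    using B by (rule eventually_mono) (rule C[rule_format], auto simp: abs_le_iff)
  then show "\<exists>B. AE x in lebesgue_on (Omega D). \<bar>g (v x)\<bar> \<le> B" ..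
qed

end

section \<open>Stability and solvability of the scheme\<close>

lemma rk_square_le:
  fixes f :: "nat \<Rightarrow> real"
  assumes "algebraically_stable s A b"
  shows "(f0 + \<tau> * (\<Sum>i=1..s. b i * f i))\<^sup>2 \<le>
    f0\<^sup>2 + 2 * \<tau> * (\<Sum>i=1..s. b i * ((f0 + \<tau> * (\<Sum>j=1..s. A i j * f j)) * f i))"
proof -
  define S where "S = (\<Sum>i=1..s. b i * f i)"
  \<comment> \<open>The first two terms of \<open>RK_M\<close> contribute \<open>T\<close> each,
    after exchanging the summation indices in the second, and the third contributes
    \<open>- S * S\<close>. The quadratic form is therefore \<open>T + T - S * S\<close>.\<close>
  define T where "T = (\<Sum>i=1..s. \<Sum>j=1..s. b i * A i j * f i * f j)"
  have "0 \<le> (\<Sum>i=1..s. \<Sum>j=1..s. f i * RK_M A b i j * f j)"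
    using assms unfolding algebraically_stable_def by blast
  also have "\<dots> = T + (\<Sum>i=1..s. \<Sum>j=1..s. b j * A j i * f j * f i) - S * S"
    unfolding T_def S_def sum_product sum.distrib[symmetric] sum_subtractf[symmetric]
    by (intro sum.cong refl) (simp add: RK_M_def algebra_simps)
  also have "(\<Sum>i=1..s. \<Sum>j=1..s. b j * A j i * f j * f i) = T"
    unfolding T_def by (rule sum.swap)
  finally have "0 \<le> \<tau>\<^sup>2 * (T + T - S * S)" by simp
  moreover have "(\<Sum>i=1..s. b i * ((f0 + \<tau> * (\<Sum>j=1..s. A i j * f j)) * f i)) = f0 * S + \<tau> * T"
    unfolding S_def T_def sum_distrib_left sum.distrib[symmetric]
    by (intro sum.cong refl) (simp add: algebra_simps sum_distrib_left sum_distrib_right)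
  ultimately show ?thesis
    unfolding S_def[symmetric] by (simp add: power2_eq_square algebra_simps)
qed

context dg
begin

section \<open>Runge-Kutta combinations in L2 and V_h\<close>

lemma rk_stage_L2:
  "f0 \<in> L2 D \<Longrightarrow> (\<And>j. j \<in> {1..s} \<Longrightarrow> f j \<in> L2 D) \<Longrightarrow> rk_stage s A \<tau> f0 f i \<in> L2 D"
  unfolding rk_stage_def[abs_def] by (intro L2_add L2_scale L2_sum)

lemma rk_stage_Vh:
  "f0 \<in> Vh D \<Longrightarrow> (\<And>j. j \<in> {1..s} \<Longrightarrow> f j \<in> Vh D) \<Longrightarrow> rk_stage s A \<tau> f0 f i \<in> Vh D"
  unfolding rk_stage_def[abs_def] by (intro Vh_add Vh_scale Vh_sum)

text \<open>The update is a stage whose coefficient row is \<open>b\<close>, so the facts about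
  stages apply to it. The stage index is a dummy, later instantiated with 0.\<close>

lemma rk_update_eq_stage: "rk_update s b \<tau> f0 f = rk_stage s (\<lambda>_. b) \<tau> f0 f i"
  by (simp add: rk_update_def rk_stage_def fun_eq_iff)

lemma Vh_functional_rk_stage:
  assumes F: "Vh_functional F" and "f0 \<in> Vh D" "\<And>j. j \<in> {1..s} \<Longrightarrow> f j \<in> Vh D"
  shows "F (rk_stage s A \<tau> f0 f i) = F f0 + \<tau> * (\<Sum>j=1..s. A i j * F (f j))"
proof -
  have "rk_stage s A \<tau> f0 f i = (\<lambda>x. 1 * f0 x + \<tau> * (\<Sum>j=1..s. A i j * f j x))"
    by (simp add: rk_stage_def fun_eq_iff)
  moreover have "F (\<lambda>x. 1 * f0 x + \<tau> * (\<Sum>j=1..s. A i j * f j x)) =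
      1 * F f0 + \<tau> * F (\<lambda>x. \<Sum>j=1..s. A i j * f j x)"
    using assms(3) by (intro Vh_functional_linear[OF F assms(2)] Vh_sum)
  ultimately have "F (rk_stage s A \<tau> f0 f i) = 1 * F f0 + \<tau> * F (\<lambda>x. \<Sum>j=1..s. A i j * f j x)"
    by (simp only:)
  also have "F (\<lambda>x. \<Sum>j=1..s. A i j * f j x) = (\<Sum>j=1..s. A i j * F (f j))"
    using assms by (intro Vh_functional_sum) auto
  finally show ?thesis by simp
qed

lemma Lh_rk_stage:
  assumes u: "u \<in> Vh D" and \<xi>: "\<And>j. j \<in> {1..s} \<Longrightarrow> \<xi> j \<in> Vh D"
    and q0: "q0 \<in> Vh D" "\<And>\<psi>. \<psi> \<in> Vh D \<Longrightarrow> ip D q0 \<psi> = G D u \<psi>"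
    and q: "q \<in> Vh D" "\<And>\<psi>. \<psi> \<in> Vh D \<Longrightarrow> ip D q \<psi> = G D (rk_stage s A \<tau> u \<xi> i) \<psi>"
  shows "eq_on D q (rk_stage s A \<tau> q0 (\<lambda>j. Lh D (\<xi> j)) i)"
proof (rule Vh_eq_onI[OF q(1)])
  show "rk_stage s A \<tau> q0 (\<lambda>j. Lh D (\<xi> j)) i \<in> Vh D"
    using q0 \<xi> by (intro rk_stage_Vh Lh_Vh)
  fix \<psi> assume \<psi>: "\<psi> \<in> Vh D"
  \<comment> \<open>By symmetry the stage moves to the second argument, where
    \<open>G D \<psi>\<close> is a linear functional that can be evaluated on a stage.\<close>
  have "ip D q \<psi> = G D \<psi> (rk_stage s A \<tau> u \<xi> i)"
    unfolding q(2)[OF \<psi>] by (rule G_commute)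
  also have "\<dots> = G D \<psi> u + \<tau> * (\<Sum>j=1..s. A i j * G D \<psi> (\<xi> j))"
    using \<xi> by (intro Vh_functional_rk_stage Vh_functional_G \<psi> u) auto
  also have "\<dots> = ip D \<psi> q0 + \<tau> * (\<Sum>j=1..s. A i j * ip D \<psi> (Lh D (\<xi> j)))"
    using \<psi> \<xi> q0(2) by (simp add: G_commute[of \<psi>] ip_commute[of \<psi>] ip_Lh)
  also have "\<dots> = ip D \<psi> (rk_stage s A \<tau> q0 (\<lambda>j. Lh D (\<xi> j)) i)"
    using \<xi> by (intro Vh_functional_rk_stage[symmetric] Vh_functional_ip Vh_L2 \<psi> q0 Lh_Vh) auto
  also have "\<dots> = ip D (rk_stage s A \<tau> q0 (\<lambda>j. Lh D (\<xi> j)) i) \<psi>" by (rule ip_commute)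
  finally show "ip D q \<psi> = ip D (rk_stage s A \<tau> q0 (\<lambda>j. Lh D (\<xi> j)) i) \<psi>" .
qed

lemma rk_ip_le:
  assumes stable: "algebraically_stable s A b"
    and f0: "f0 \<in> L2 D" and f: "\<And>j. j \<in> {1..s} \<Longrightarrow> f j \<in> L2 D"
  shows "ip D (rk_update s b \<tau> f0 f) (rk_update s b \<tau> f0 f) \<le>
    ip D f0 f0 + 2 * \<tau> * (\<Sum>i=1..s. b i * ip D (rk_stage s A \<tau> f0 f i) (f i))"
proof -
  let ?M = "lebesgue_on (Omega D)"
  let ?y = "rk_update s b \<tau> f0 f" and ?z = "rk_stage s A \<tau> f0 f"
  have y: "?y \<in> L2 D" unfolding rk_update_eq_stage[where i = 0] using f0 f by (intro rk_stage_L2)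
  have z: "?z i \<in> L2 D" for i using f0 f by (intro rk_stage_L2)
  have int: "integrable ?M (\<lambda>x. \<Sum>i=1..s. b i * (?z i x * f i x))"
    using z f by (intro Bochner_Integration.integrable_sum integrable_mult_right L2_integrable_mult)
  have "ip D ?y ?y \<le> (LINT x|?M. f0 x * f0 x + 2 * \<tau> * (\<Sum>i=1..s. b i * (?z i x * f i x)))"
    unfolding ip_def
  proof (rule integral_mono)
    show "integrable ?M (\<lambda>x. ?y x * ?y x)" using y y by (rule L2_integrable_mult)
    show "integrable ?M (\<lambda>x. f0 x * f0 x + 2 * \<tau> * (\<Sum>i=1..s. b i * (?z i x * f i x)))"
      using f0 int by (intro Bochner_Integration.integrable_add integrable_mult_right L2_integrable_mult)
    show "?y x * ?y x \<le> f0 x * f0 x + 2 * \<tau> * (\<Sum>i=1..s. b i * (?z i x * f i x))" for x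
      using rk_square_le[OF stable, of "f0 x" \<tau> "\<lambda>i. f i x"]
      by (simp add: rk_update_def rk_stage_def power2_eq_square)
  qed
  also have "\<dots> = ip D f0 f0 + 2 * \<tau> * (LINT x|?M. (\<Sum>i=1..s. b i * (?z i x * f i x)))"
    unfolding ip_def using L2_integrable_mult[OF f0 f0] int by simp
  also have "(LINT x|?M. (\<Sum>i=1..s. b i * (?z i x * f i x))) = (\<Sum>i=1..s. b i * ip D (?z i) (f i))"
    unfolding ip_def using z f
    by (subst Bochner_Integration.integral_sum)
      (auto intro!: integrable_mult_right L2_integrable_mult)
  finally show ?thesis .
qed

end

section \<open>The energy law of one step\<close>

locale leqrk_step = dg D \<sigma> for D :: "'a::euclidean_space dg_setting" and \<sigma> :: real +
  fixes \<Phi> :: "real \<Rightarrow> real" and C0 \<tau> :: real and s :: nat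
    and A :: "nat \<Rightarrow> nat \<Rightarrow> real" and b :: "nat \<Rightarrow> real" and ustar :: "nat \<Rightarrow> 'a \<Rightarrow> real"
  assumes Phi_diff: "\<forall>w. \<Phi> field_differentiable at w"
    and Phi_C1: "continuous_on UNIV (deriv \<Phi>)"
    and C0: "\<forall>w. 0 < \<Phi> w + C0"
    and stable: "algebraically_stable s A b"
    and ustar: "\<forall>i\<in>{1..s}. ustar i \<in> Vh D"
    and step: "0 < \<tau>"
begin

abbreviation h :: "nat \<Rightarrow> 'a \<Rightarrow> real" where
  "h i x \<equiv> H \<Phi> C0 (ustar i x)"

abbreviation l :: "(nat \<Rightarrow> 'a \<Rightarrow> real) \<Rightarrow> nat \<Rightarrow> 'a \<Rightarrow> real" where
  "l \<xi> \<equiv> stage_l \<Phi> C0 ustar \<xi>"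

abbreviation active :: "nat set" where
  "active \<equiv> {i\<in>{1..s}. b i \<noteq> 0}"

lemma b_nonneg: "i \<in> {1..s} \<Longrightarrow> 0 \<le> b i"
  using stable by (simp add: algebraically_stable_def)

lemma continuous_H: "continuous_on UNIV (H \<Phi> C0)"
proof -
  have "continuous_on UNIV \<Phi>"
    using Phi_diff by (intro continuous_at_imp_continuous_on ballI field_differentiable_imp_continuous_at) simp
  then show ?thesis
    unfolding H_def[abs_def] using Phi_C1 C0
    by (intro continuous_on_divide continuous_on_real_sqrt continuous_on_add continuous_on_const)
      (simp_all add: less_imp_neq[symmetric])
qed

lemma h_mult_L2:
  assumes "i \<in> {1..s}" "f \<in> L2 D"
  shows "(\<lambda>x. h i x * f x) \<in> L2 D"
proof -
  have v: "ustar i \<in> Vh D" using ustar assms(1) by simp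
  from continuous_comp_Vh(2)[OF v continuous_H] obtain B
    where "AE x in lebesgue_on (Omega D). \<bar>h i x\<bar> \<le> B" ..
  from L2_bounded_mult[OF continuous_comp_Vh(1)[OF v continuous_H] this assms(2)] show ?thesis .
qed

lemma l_L2:
  assumes "i \<in> {1..s}" "\<xi> i \<in> L2 D"
  shows "l \<xi> i \<in> L2 D"
proof -
  have "l \<xi> i = (\<lambda>x. 1 / 2 * (h i x * \<xi> i x))" by (simp add: stage_l_def fun_eq_iff)
  then show ?thesis using L2_scale[OF h_mult_L2[OF assms], of "1 / 2"] by (simp only:)
qed

lemma rk_update_l_L2:
  assumes "U \<in> L2 D" "\<And>i. i \<in> {1..s} \<Longrightarrow> \<xi> i \<in> Vh D"
  shows "rk_update s b \<tau> U (l \<xi>) \<in> L2 D"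
  unfolding rk_update_eq_stage[where i = 0]
  using assms by (intro rk_stage_L2 l_L2) (auto intro: Vh_L2)

text \<open>The hypotheses are weak identities, and the stage equations are required for the active
  stages only. In this form the estimate covers the scheme itself, differences of solutions and the
  kernel of the linear system. It bounds the new value of U before projection.\<close>

lemma energy_estimate:
  assumes u: "u \<in> Vh D" and U: "U \<in> L2 D"
    and q0: "q0 \<in> Vh D" "\<And>\<psi>. \<psi> \<in> Vh D \<Longrightarrow> ip D q0 \<psi> = G D u \<psi>"
    and \<xi>: "\<And>i. i \<in> {1..s} \<Longrightarrow> \<xi> i \<in> Vh D"
    and q: "\<And>i. i \<in> {1..s} \<Longrightarrow> q i \<in> Vh D"
      "\<And>i \<psi>. i \<in> {1..s} \<Longrightarrow> \<psi> \<in> Vh D \<Longrightarrow> ip D (q i) \<psi> = G D (rk_stage s A \<tau> u \<xi> i) \<psi>"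
    and eqn: "\<And>i \<phi>. i \<in> active \<Longrightarrow> \<phi> \<in> Vh D \<Longrightarrow>
      ip D (\<xi> i) \<phi> = - G D (q i) \<phi> - ip D (\<lambda>x. h i x * rk_stage s A \<tau> U (l \<xi>) i x) \<phi>"
    and q1: "q1 \<in> Vh D" "\<And>\<psi>. \<psi> \<in> Vh D \<Longrightarrow> ip D q1 \<psi> = G D (rk_update s b \<tau> u \<xi>) \<psi>"
  shows "1 / 2 * ip D q1 q1 + ip D (rk_update s b \<tau> U (l \<xi>)) (rk_update s b \<tau> U (l \<xi>))
    \<le> 1 / 2 * ip D q0 q0 + ip D U U - \<tau> * (\<Sum>i=1..s. b i * ip D (\<xi> i) (\<xi> i))"
proof -
  define \<eta> where "\<eta> = (\<lambda>i. Lh D (\<xi> i))"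
  have \<eta>: "\<eta> i \<in> Vh D" if "i \<in> {1..s}" for i unfolding \<eta>_def using \<xi>[OF that] by (rule Lh_Vh)
  let ?Q = "rk_stage s A \<tau> q0 \<eta>" and ?U = "rk_stage s A \<tau> U (l \<xi>)"
  let ?Q1 = "rk_update s b \<tau> q0 \<eta>" and ?U1 = "rk_update s b \<tau> U (l \<xi>)"
  have lL2: "l \<xi> i \<in> L2 D" if "i \<in> {1..s}" for i using that \<xi>[OF that] by (intro l_L2 Vh_L2)
  have Q: "eq_on D (q i) (?Q i)" if "i \<in> {1..s}" for i
    unfolding \<eta>_def using q that by (intro Lh_rk_stage[OF u \<xi> q0]) auto
  have Q1: "eq_on D q1 ?Q1"
    using q1 unfolding \<eta>_def rk_update_eq_stage[where i = 0] by (intro Lh_rk_stage[OF u \<xi> q0]) auto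
  \<comment> \<open>Replacing the stage by \<open>q i\<close> and moving \<open>Lh\<close> off
    \<open>\<xi> i\<close> produces the term of the stage equation tested with
    \<open>\<xi> i\<close>.\<close>
  have Qi: "ip D (?Q i) (\<eta> i) = G D (q i) (\<xi> i)" if i: "i \<in> {1..s}" for i
  proof -
    have "ip D (?Q i) (\<eta> i) = ip D (q i) (\<eta> i)"
      using i q \<eta> q0 by (intro ip_cong eq_on_refl eq_on_sym[OF Q] Vh_L2 rk_stage_Vh) auto
    also have "\<dots> = ip D (Lh D (\<xi> i)) (q i)" unfolding \<eta>_def by (rule ip_commute)
    also have "\<dots> = G D (q i) (\<xi> i)"
      using ip_Lh[OF \<xi>[OF i] q(1)[OF i]] G_commute by simp
    finally show ?thesis .
  qed
  \<comment> \<open>The energy carries weight 1 on U and 1/2 on q. The resulting factor 2 cancels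
    the 1/2 in l_i and leaves the nonlinear term of the stage equation tested with
    \<open>\<xi> i\<close>.\<close>
  have Ui: "2 * ip D (?U i) (l \<xi> i) = ip D (\<lambda>x. h i x * ?U i x) (\<xi> i)" for i
    unfolding ip_def stage_l_def by (simp add: mult_ac flip: integral_mult_right_zero)
  have sum: "(\<Sum>i=1..s. b i * ip D (?Q i) (\<eta> i)) + (\<Sum>i=1..s. b i * (2 * ip D (?U i) (l \<xi> i))) =
      - (\<Sum>i=1..s. b i * ip D (\<xi> i) (\<xi> i))"
    unfolding sum.distrib[symmetric] sum_negf[symmetric]
  proof (intro sum.cong refl)
    fix i assume i: "i \<in> {1..s}"
    \<comment> \<open>An inactive stage offers no equation, but then all terms of the identity carry
      the factor b_i = 0.\<close>
    have "b i = 0 \<or> ip D (\<xi> i) (\<xi> i) = - G D (q i) (\<xi> i) - ip D (\<lambda>x. h i x * ?U i x) (\<xi> i)"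
      using eqn[OF _ \<xi>[OF i], of i] i by auto
    moreover have "\<beta> * g + \<beta> * y = - (\<beta> * x)" if "\<beta> = 0 \<or> x = - g - y" for \<beta> g x y :: real
      using that by (elim disjE) (simp_all add: right_diff_distrib)
    ultimately show "b i * ip D (?Q i) (\<eta> i) + b i * (2 * ip D (?U i) (l \<xi> i)) = - (b i * ip D (\<xi> i) (\<xi> i))"
      unfolding Qi[OF i] Ui by blast
  qed
  have "ip D q1 q1 = ip D ?Q1 ?Q1"
    using Q1 q1 q0 \<eta> unfolding rk_update_eq_stage[where i = 0]
    by (intro ip_cong Vh_L2 rk_stage_Vh)
  also have "\<dots> \<le> ip D q0 q0 + 2 * \<tau> * (\<Sum>i=1..s. b i * ip D (?Q i) (\<eta> i))"
    using q0 \<eta> by (intro rk_ip_le stable Vh_L2)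
  finally have "1 / 2 * ip D q1 q1 \<le> 1 / 2 * ip D q0 q0 + \<tau> * (\<Sum>i=1..s. b i * ip D (?Q i) (\<eta> i))"
    by simp
  moreover have "ip D ?U1 ?U1 \<le> ip D U U + 2 * \<tau> * (\<Sum>i=1..s. b i * ip D (?U i) (l \<xi> i))"
    using U lL2 by (intro rk_ip_le stable)
  moreover have "2 * \<tau> * (\<Sum>i=1..s. b i * ip D (?U i) (l \<xi> i)) =
      \<tau> * (\<Sum>i=1..s. b i * (2 * ip D (?U i) (l \<xi> i)))"
    by (simp add: sum_distrib_left mult_ac)
  moreover have "\<tau> * (\<Sum>i=1..s. b i * ip D (?Q i) (\<eta> i)) + \<tau> * (\<Sum>i=1..s. b i * (2 * ip D (?U i) (l \<xi> i))) =
      - (\<tau> * (\<Sum>i=1..s. b i * ip D (\<xi> i) (\<xi> i)))"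
    unfolding distrib_left[symmetric] sum by simp
  ultimately show ?thesis by linarith
qed

lemma G_zero: "v \<in> Vh D \<Longrightarrow> G D (\<lambda>x. 0) v = 0"
  using G_linear[OF Vh_zero Vh_zero, of v 0 0] by simp

text \<open>With zero data the old energy is 0 and the new one nonnegative, so the nonnegative
  dissipation terms all vanish. The inactive stages are left arbitrary. This serves both uniqueness
  and the trivial kernel needed for existence.\<close>

lemma homogeneous_stages_vanish:
  assumes \<xi>: "\<And>i. i \<in> {1..s} \<Longrightarrow> \<xi> i \<in> Vh D"
    and q: "\<And>i. i \<in> {1..s} \<Longrightarrow> q i \<in> Vh D"
      "\<And>i \<psi>. i \<in> {1..s} \<Longrightarrow> \<psi> \<in> Vh D \<Longrightarrow> ip D (q i) \<psi> = G D (rk_stage s A \<tau> (\<lambda>x. 0) \<xi> i) \<psi>"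
    and eqn: "\<And>i \<phi>. i \<in> active \<Longrightarrow> \<phi> \<in> Vh D \<Longrightarrow>
      ip D (\<xi> i) \<phi> = - G D (q i) \<phi> - ip D (\<lambda>x. h i x * rk_stage s A \<tau> (\<lambda>x. 0) (l \<xi>) i x) \<phi>"
    and i: "i \<in> active"
  shows "eq_on D (\<xi> i) (\<lambda>x. 0)"
proof -
  let ?u1 = "rk_update s b \<tau> (\<lambda>x. 0) \<xi>" and ?U1 = "rk_update s b \<tau> (\<lambda>x. 0) (l \<xi>)"
  have u1: "?u1 \<in> Vh D"
    unfolding rk_update_eq_stage[where i = 0] using \<xi> by (intro rk_stage_Vh Vh_zero)
  have "1 / 2 * ip D (Lh D ?u1) (Lh D ?u1) + ip D ?U1 ?U1 \<le>
      1 / 2 * ip D (\<lambda>x. 0) (\<lambda>x. 0) + ip D (\<lambda>x. 0) (\<lambda>x. 0) - \<tau> * (\<Sum>i=1..s. b i * ip D (\<xi> i) (\<xi> i))"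
    using \<xi> q eqn u1
    by (intro energy_estimate[where u = "\<lambda>x. 0" and q = q] Vh_zero L2_zero Lh_Vh)
      (simp_all add: ip_zero G_zero ip_Lh)
  moreover have "0 \<le> ip D (Lh D ?u1) (Lh D ?u1)" "0 \<le> ip D ?U1 ?U1" by (rule ip_nonneg)+
  ultimately have "\<tau> * (\<Sum>i=1..s. b i * ip D (\<xi> i) (\<xi> i)) \<le> 0" by (simp add: ip_zero)
  then have "(\<Sum>i=1..s. b i * ip D (\<xi> i) (\<xi> i)) \<le> 0" using step by (simp add: mult_le_0_iff)
  moreover have nonneg: "0 \<le> b i * ip D (\<xi> i) (\<xi> i)" if "i \<in> {1..s}" for i
    using b_nonneg[OF that] ip_nonneg by (rule mult_nonneg_nonneg)
  ultimately have "(\<Sum>i=1..s. b i * ip D (\<xi> i) (\<xi> i)) = 0"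
    using sum_nonneg[of "{1..s}" "\<lambda>i. b i * ip D (\<xi> i) (\<xi> i)"] by auto
  then have "\<forall>i\<in>{1..s}. b i * ip D (\<xi> i) (\<xi> i) = 0"
    using nonneg sum_nonneg_eq_0_iff[of "{1..s}" "\<lambda>i. b i * ip D (\<xi> i) (\<xi> i)"] by blast
  with i have "ip D (\<xi> i) (\<xi> i) = 0" by auto
  then show ?thesis using \<xi> i by (intro ip_eq_0 Vh_L2) auto
qed

section \<open>Joint linearity of the stage equations and their solution\<close>

lemma rk_stage_linear:
  "rk_stage s A \<tau> (\<lambda>x. a * f0 x + c * g0 x) (\<lambda>j x. a * f j x + c * g j x) i =
    (\<lambda>x. a * rk_stage s A \<tau> f0 f i x + c * rk_stage s A \<tau> g0 g i x)"
  by (simp add: rk_stage_def fun_eq_iff sum.distrib algebra_simps flip: sum_distrib_left)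

lemma l_linear:
  "l (\<lambda>j x. a * f j x + c * g j x) = (\<lambda>j x. a * l f j x + c * l g j x)"
  by (simp add: stage_l_def fun_eq_iff algebra_simps)

lemma ip_h_stage_linear:
  assumes i: "i \<in> {1..s}" and \<phi>: "\<phi> \<in> Vh D" and U: "U \<in> L2 D" "V \<in> L2 D"
    and \<xi>: "\<And>j. j \<in> {1..s} \<Longrightarrow> \<xi> j \<in> Vh D" "\<And>j. j \<in> {1..s} \<Longrightarrow> \<zeta> j \<in> Vh D"
  shows "ip D (\<lambda>x. h i x * rk_stage s A \<tau> (\<lambda>x. a * U x + c * V x) (l (\<lambda>j x. a * \<xi> j x + c * \<zeta> j x)) i x) \<phi> =
    a * ip D (\<lambda>x. h i x * rk_stage s A \<tau> U (l \<xi>) i x) \<phi> +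
    c * ip D (\<lambda>x. h i x * rk_stage s A \<tau> V (l \<zeta>) i x) \<phi>"
proof -
  have L: "(\<lambda>x. h i x * rk_stage s A \<tau> U (l \<xi>) i x) \<in> L2 D"
    if "U \<in> L2 D" "\<And>j. j \<in> {1..s} \<Longrightarrow> \<xi> j \<in> Vh D" for U \<xi>
    using that by (intro h_mult_L2 i rk_stage_L2 l_L2) (auto intro: Vh_L2)
  have "(\<lambda>x. h i x * rk_stage s A \<tau> (\<lambda>x. a * U x + c * V x) (l (\<lambda>j x. a * \<xi> j x + c * \<zeta> j x)) i x) =
    (\<lambda>x. a * (h i x * rk_stage s A \<tau> U (l \<xi>) i x) + c * (h i x * rk_stage s A \<tau> V (l \<zeta>) i x))"
    unfolding l_linear rk_stage_linear by (simp add: algebra_simps)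
  then show ?thesis
    using ip_linear[OF L[OF U(1) \<xi>(1)] L[OF U(2) \<xi>(2)] Vh_L2[OF \<phi>]] by simp
qed

text \<open>Coordinates of the active stages. Setting the inactive ones to 0 leaves one unknown for
  each pair of an active stage and a basis function, as many as there are tested equations.\<close>

definition stage_combination :: "('a \<Rightarrow> real) set \<Rightarrow> (nat \<times> ('a \<Rightarrow> real) \<Rightarrow> real) \<Rightarrow> nat \<Rightarrow> 'a \<Rightarrow> real" where
  "stage_combination B z i x = (if i \<in> active then \<Sum>e\<in>B. z (i, e) * e x else 0)"

lemma stage_combination_Vh:
  assumes "orthonormal B"
  shows "stage_combination B z i \<in> Vh D"
proof (cases "i \<in> active")
  case True
  then have "stage_combination B z i = (\<lambda>x. \<Sum>e\<in>B. z (i, e) * e x)"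
    by (simp add: stage_combination_def fun_eq_iff)
  moreover have "(\<lambda>x. \<Sum>e\<in>B. z (i, e) * e x) \<in> Vh D"
    using assms by (intro Vh_sum) (auto simp: orthonormal_def)
  ultimately show ?thesis by simp
next
  case False
  then have "stage_combination B z i = (\<lambda>x. 0)"
    by (auto simp: stage_combination_def fun_eq_iff)
  then show ?thesis using Vh_zero by simp
qed

lemma stage_combination_linear:
  "stage_combination B (\<lambda>j. a * z j + c * w j) =
    (\<lambda>i x. a * stage_combination B z i x + c * stage_combination B w i x)"
proof (intro ext)
  fix i x
  have "(\<Sum>e\<in>B. (a * z (i, e) + c * w (i, e)) * e x) =
      a * (\<Sum>e\<in>B. z (i, e) * e x) + c * (\<Sum>e\<in>B. w (i, e) * e x)"
    by (simp only: distrib_right sum.distrib sum_distrib_left mult.assoc)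
  then show "stage_combination B (\<lambda>j. a * z j + c * w j) i x =
      a * stage_combination B z i x + c * stage_combination B w i x"
    by (simp add: stage_combination_def)
qed

lemma ip_stage_combination:
  assumes "orthonormal B" "i \<in> active" "e \<in> B"
  shows "ip D (stage_combination B z i) e = z (i, e)"
proof -
  have "stage_combination B z i = (\<lambda>x. \<Sum>e\<in>B. z (i, e) * e x)"
    using assms(2) by (simp add: stage_combination_def fun_eq_iff)
  then show ?thesis using ip_orthonormal_sum[OF assms(1,3), of "\<lambda>e. z (i, e)"] by simp
qed

text \<open>The unknowns q_i are eliminated as \<open>Lh\<close> of the stages. What remains is
  affine in \<xi>: the residual is jointly linear in u, U and \<xi>, so it splits into a part with
  the data and \<xi> = 0 and a part with zero data, which is linear in the coordinates.\<close>

lemma active_stages_solvable: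
  assumes u: "u \<in> Vh D" and U: "U \<in> L2 D"
  shows "\<exists>\<xi>. (\<forall>i. \<xi> i \<in> Vh D) \<and> (\<forall>i\<in>active. \<forall>\<phi>\<in>Vh D.
    ip D (\<xi> i) \<phi> = - G D (Lh D (rk_stage s A \<tau> u \<xi> i)) \<phi>
      - ip D (\<lambda>x. h i x * rk_stage s A \<tau> U (l \<xi>) i x) \<phi>)"
proof -
  obtain B where B: "orthonormal B" "\<And>v. v \<in> Vh D \<Longrightarrow> eq_on D v (component B v)"
    by (rule orthonormal_basis) blast
  have BV: "e \<in> Vh D" if "e \<in> B" for e using B(1) that by (auto simp: orthonormal_def)
  define R where "R u U \<xi> i \<phi> = ip D (\<xi> i) \<phi> + G D (Lh D (rk_stage s A \<tau> u \<xi> i)) \<phi>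
      + ip D (\<lambda>x. h i x * rk_stage s A \<tau> U (l \<xi>) i x) \<phi>"
    for u U :: "'a \<Rightarrow> real" and \<xi> :: "nat \<Rightarrow> 'a \<Rightarrow> real" and i and \<phi> :: "'a \<Rightarrow> real"
  let ?X = "stage_combination B"
  have X: "?X z i \<in> Vh D" for z i using B(1) by (rule stage_combination_Vh)
  have stage: "rk_stage s A \<tau> u (?X z) i \<in> Vh D" if "u \<in> Vh D" for u z i
    using that X by (intro rk_stage_Vh)
  have R_functional: "Vh_functional (R u U (?X z) i)"
    if "i \<in> active" "u \<in> Vh D" "U \<in> L2 D" for u U z i
    unfolding R_def using that X
    by (intro Vh_functional_add Vh_functional_ip Vh_functional_G Lh_Vh stage h_mult_L2 rk_stage_L2 l_L2)
      (auto intro: Vh_L2)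
  \<comment> \<open>The residual is a linear functional of the test function, so testing with the
    basis suffices.\<close>
  have R_zero: "\<forall>\<phi>\<in>Vh D. R u U (?X z) i \<phi> = 0"
    if "i \<in> active" "u \<in> Vh D" "U \<in> L2 D" "\<forall>e\<in>B. R u U (?X z) i e = 0" for u U z i
    using Vh_functional_eq[OF B R_functional[OF that(1-3)]] that(4) by simp
  \<comment> \<open>The chosen representatives \<open>Lh D v\<close> are linear in \<open>v\<close>
    only almost everywhere. Self-adjointness moves \<open>Lh\<close> to the fixed test function, and
    linearity in \<open>v\<close> becomes linearity of \<open>G\<close>.\<close>
  have GL: "G D (Lh D v) \<phi> = G D v (Lh D \<phi>)" if "v \<in> Vh D" "\<phi> \<in> Vh D" for v \<phi>
  proof -
    have "G D (Lh D v) \<phi> = ip D (Lh D \<phi>) (Lh D v)"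
      using that by (simp add: ip_Lh Lh_Vh G_commute[of \<phi>])
    also have "\<dots> = ip D (Lh D v) (Lh D \<phi>)" by (rule ip_commute)
    finally show ?thesis using that by (simp add: ip_Lh Lh_Vh)
  qed
  have R_linear: "R (\<lambda>x. a * v x + c * w x) (\<lambda>x. a * V x + c * W x) (?X (\<lambda>j. a * y j + c * z j)) i \<phi> =
      a * R v V (?X y) i \<phi> + c * R w W (?X z) i \<phi>"
    if "i \<in> active" "\<phi> \<in> Vh D" "v \<in> Vh D" "w \<in> Vh D" "V \<in> L2 D" "W \<in> L2 D" for a c v w V W y z i \<phi>
  proof -
    have "ip D (\<lambda>x. a * ?X y i x + c * ?X z i x) \<phi> = a * ip D (?X y i) \<phi> + c * ip D (?X z i) \<phi>"
      using X that by (intro ip_linear Vh_L2)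
    moreover have "G D (Lh D (\<lambda>x. a * rk_stage s A \<tau> v (?X y) i x + c * rk_stage s A \<tau> w (?X z) i x)) \<phi> =
        a * G D (Lh D (rk_stage s A \<tau> v (?X y) i)) \<phi> + c * G D (Lh D (rk_stage s A \<tau> w (?X z) i)) \<phi>"
      using that stage by (simp add: GL Vh_linear G_linear Lh_Vh)
    moreover have "ip D (\<lambda>x. h i x * rk_stage s A \<tau> (\<lambda>x. a * V x + c * W x)
          (l (\<lambda>j x. a * ?X y j x + c * ?X z j x)) i x) \<phi> =
        a * ip D (\<lambda>x. h i x * rk_stage s A \<tau> V (l (?X y)) i x) \<phi> +
        c * ip D (\<lambda>x. h i x * rk_stage s A \<tau> W (l (?X z)) i x) \<phi>"
      using that X by (intro ip_h_stage_linear) auto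
    ultimately show ?thesis
      unfolding R_def stage_combination_linear rk_stage_linear by (simp only: algebra_simps)
  qed
  let ?F = "\<lambda>z (i, e). R (\<lambda>x. 0) (\<lambda>x. 0) (?X z) i e"
  let ?I = "active \<times> B"
  have F_linear: "?F (\<lambda>j. a * y j + c * z j) k = a * ?F y k + c * ?F z k" if "k \<in> ?I" for a c y z k
    using that BV R_linear[OF _ _ Vh_zero Vh_zero L2_zero L2_zero, of "fst k" "snd k" a c y z]
    by auto
  have "\<exists>z. \<forall>k\<in>?I. ?F z k = (case k of (i, e) \<Rightarrow> - R u U (?X (\<lambda>_. 0)) i e)"
  proof (rule linear_system_solvable)
    show "finite ?I" using B(1) by (simp add: orthonormal_def)
    show "?F (\<lambda>j. y j + z j) k = ?F y k + ?F z k" if "k \<in> ?I" for y z k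
      using F_linear[OF that, of 1 y 1 z] by simp
    show "?F (\<lambda>j. c * z j) k = c * ?F z k" if "k \<in> ?I" for c z k
      using F_linear[OF that, of c z 0 z] by simp
    fix z assume z: "\<forall>k\<in>?I. ?F z k = 0"
    have "z (i, e) = 0" if i: "i \<in> active" and e: "e \<in> B" for i e
    proof -
      have "eq_on D (?X z i) (\<lambda>x. 0)"
      proof (rule homogeneous_stages_vanish[where \<xi> = "?X z" and q = "\<lambda>i. Lh D (rk_stage s A \<tau> (\<lambda>x. 0) (?X z) i)"])
        fix i \<phi> assume i: "i \<in> active" and \<phi>: "\<phi> \<in> Vh D"
        have "R (\<lambda>x. 0) (\<lambda>x. 0) (?X z) i \<phi> = 0"
          using R_zero[OF i Vh_zero L2_zero] z i \<phi> by auto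
        then show "ip D (?X z i) \<phi> = - G D (Lh D (rk_stage s A \<tau> (\<lambda>x. 0) (?X z) i)) \<phi>
            - ip D (\<lambda>x. h i x * rk_stage s A \<tau> (\<lambda>x. 0) (l (?X z)) i x) \<phi>"
          unfolding R_def by linarith
      qed (use i in \<open>simp_all add: X stage Vh_zero Lh_Vh ip_Lh\<close>)
      then have "ip D (?X z i) e = ip D (\<lambda>x. 0) e"
        using X BV[OF e] by (intro ip_cong eq_on_refl Vh_L2 Vh_zero)
      then show ?thesis using ip_stage_combination[OF B(1) i e, of z] by (simp add: ip_zero)
    qed
    then show "\<forall>k\<in>?I. z k = 0" by auto
  qed
  then obtain z where z: "\<forall>k\<in>?I. ?F z k = (case k of (i, e) \<Rightarrow> - R u U (?X (\<lambda>_. 0)) i e)" ..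
  have "R u U (?X z) i e = 0" if i: "i \<in> active" and e: "e \<in> B" for i e
  proof -
    \<comment> \<open>Joint linearity with both coefficients 1: the data go with zero coordinates
      and the coordinates \<open>z\<close> with zero data. By the choice of \<open>z\<close> the two
      parts cancel.\<close>
    have "R u U (?X z) i e = R u U (?X (\<lambda>_. 0)) i e + R (\<lambda>x. 0) (\<lambda>x. 0) (?X z) i e"
      using R_linear[OF i BV[OF e] u Vh_zero U L2_zero, of 1 1 "\<lambda>_. 0" z] by simp
    also have "\<dots> = 0" using z i e by auto
    finally show ?thesis .
  qed
  then have R0: "R u U (?X z) i \<phi> = 0" if "i \<in> active" "\<phi> \<in> Vh D" for i \<phi>
    using R_zero[OF that(1) u U] that by blast
  show ?thesis
  proof (intro exI[of _ "?X z"] conjI allI ballI)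
    fix i \<phi> assume "i \<in> active" "\<phi> \<in> Vh D"
    from R0[OF this] show "ip D (?X z i) \<phi> = - G D (Lh D (rk_stage s A \<tau> u (?X z) i)) \<phi>
        - ip D (\<lambda>x. h i x * rk_stage s A \<tau> U (l (?X z)) i x) \<phi>"
      unfolding R_def by linarith
  qed (rule X)
qed

section \<open>Existence, uniqueness and energy stability of the step\<close>

lemma leqrk_dg_exists:
  assumes u: "u \<in> Vh D" and U: "U \<in> Vh D"
  shows "\<exists>\<xi> q u1 q1 U1. leqrk_dg D \<Phi> C0 s A b \<tau> u U ustar active \<xi> q u1 q1 U1"
proof -
  from active_stages_solvable[OF u Vh_L2[OF U]] obtain \<xi> where \<xi>: "\<forall>i. \<xi> i \<in> Vh D"
    and eqn: "\<forall>i\<in>active. \<forall>\<phi>\<in>Vh D. ip D (\<xi> i) \<phi> = - G D (Lh D (rk_stage s A \<tau> u \<xi> i)) \<phi>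
      - ip D (\<lambda>x. h i x * rk_stage s A \<tau> U (l \<xi>) i x) \<phi>"
    by (elim exE conjE)
  have stage: "rk_stage s A \<tau> u \<xi> i \<in> Vh D" for i using \<xi> u by (intro rk_stage_Vh) auto
  have u1: "rk_update s b \<tau> u \<xi> \<in> Vh D"
    unfolding rk_update_eq_stage[where i = 0] using \<xi> u by (intro rk_stage_Vh) auto
  have U1: "rk_update s b \<tau> U (l \<xi>) \<in> L2 D"
    using \<xi> by (intro rk_update_l_L2 Vh_L2[OF U]) auto
  have "leqrk_dg D \<Phi> C0 s A b \<tau> u U ustar active \<xi> (\<lambda>i. Lh D (rk_stage s A \<tau> u \<xi> i))
      (rk_update s b \<tau> u \<xi>) (Lh D (rk_update s b \<tau> u \<xi>)) (L2proj D (rk_update s b \<tau> U (l \<xi>)))"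
    unfolding leqrk_dg_def
    using \<xi> eqn stage u1 U1 by (simp add: Lh_Vh ip_Lh L2proj_Vh eq_on_refl)
  then show ?thesis by blast
qed

text \<open>Only the active stages of two solutions are shown to agree. The inactive ones may
  differ, but both updates multiply them by b_i = 0.\<close>

lemma leqrk_dg_unique:
  assumes u: "u \<in> Vh D" and U: "U \<in> Vh D" and J: "active \<subseteq> J"
    and sol: "leqrk_dg D \<Phi> C0 s A b \<tau> u U ustar J \<xi> q u1 q1 U1"
    and sol': "leqrk_dg D \<Phi> C0 s A b \<tau> u U ustar J \<xi>' q' u1' q1' U1'"
  shows "eq_on D u1 u1' \<and> eq_on D q1 q1' \<and> eq_on D U1 U1'"
proof -
  note S = sol[unfolded leqrk_dg_def] and S' = sol'[unfolded leqrk_dg_def]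
  have \<xi>: "\<xi> i \<in> Vh D" "\<xi>' i \<in> Vh D" "q i \<in> Vh D" "q' i \<in> Vh D" if "i \<in> {1..s}" for i
    using S S' that by blast+
  let ?d = "\<lambda>i x. 1 * \<xi> i x + (-1) * \<xi>' i x" and ?p = "\<lambda>i x. 1 * q i x + (-1) * q' i x"
  \<comment> \<open>Zero data are written as the difference of the common data with themselves, in
    the shape to which the linearity lemmas apply.\<close>
  have zero: "(\<lambda>x. 0) = (\<lambda>x. 1 * v x + (-1) * v x)" for v :: "'a \<Rightarrow> real" by simp
  have "eq_on D (?d i) (\<lambda>x. 0)" if "i \<in> active" for i
  proof (rule homogeneous_stages_vanish[where q = ?p, OF _ _ _ _ that])
    fix i assume i: "i \<in> {1..s}"
    show "?d i \<in> Vh D" "?p i \<in> Vh D" using \<xi>[OF i] by (intro Vh_linear; simp)+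
    fix \<psi> assume \<psi>: "\<psi> \<in> Vh D"
    have "ip D (?p i) \<psi> = 1 * ip D (q i) \<psi> + (-1) * ip D (q' i) \<psi>"
      using \<xi>[OF i] \<psi> by (intro ip_linear Vh_L2)
    also have "\<dots> = 1 * G D (rk_stage s A \<tau> u \<xi> i) \<psi> + (-1) * G D (rk_stage s A \<tau> u \<xi>' i) \<psi>"
      using S S' i \<psi> by simp
    also have "\<dots> = G D (\<lambda>x. 1 * rk_stage s A \<tau> u \<xi> i x + (-1) * rk_stage s A \<tau> u \<xi>' i x) \<psi>"
      using \<xi> u \<psi> by (intro G_linear[symmetric] rk_stage_Vh)
    also have "\<dots> = G D (rk_stage s A \<tau> (\<lambda>x. 0) ?d i) \<psi>"
      unfolding zero[of u] by (simp only: rk_stage_linear)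
    finally show "ip D (?p i) \<psi> = G D (rk_stage s A \<tau> (\<lambda>x. 0) ?d i) \<psi>" .
  next
    fix i \<phi> assume i: "i \<in> active" and \<phi>: "\<phi> \<in> Vh D"
    then have i': "i \<in> {1..s}" "i \<in> J" using J by auto
    let ?P = "\<lambda>\<xi>. ip D (\<lambda>x. h i x * rk_stage s A \<tau> U (l \<xi>) i x) \<phi>"
    have "ip D (?d i) \<phi> = 1 * ip D (\<xi> i) \<phi> + (-1) * ip D (\<xi>' i) \<phi>"
      using \<xi>[OF i'(1)] \<phi> by (intro ip_linear Vh_L2)
    also have "ip D (\<xi> i) \<phi> = - G D (q i) \<phi> - ?P \<xi>" using S i' \<phi> by blast
    also have "ip D (\<xi>' i) \<phi> = - G D (q' i) \<phi> - ?P \<xi>'" using S' i' \<phi> by blast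
    also have "1 * (- G D (q i) \<phi> - ?P \<xi>) + (-1) * (- G D (q' i) \<phi> - ?P \<xi>') =
        - (1 * G D (q i) \<phi> + (-1) * G D (q' i) \<phi>) - (1 * ?P \<xi> + (-1) * ?P \<xi>')"
      by simp
    also have "1 * G D (q i) \<phi> + (-1) * G D (q' i) \<phi> = G D (?p i) \<phi>"
      using \<xi>[OF i'(1)] \<phi> by (intro G_linear[symmetric])
    also have "1 * ?P \<xi> + (-1) * ?P \<xi>' = ip D (\<lambda>x. h i x * rk_stage s A \<tau> (\<lambda>x. 0) (l ?d) i x) \<phi>"
      unfolding zero[of U] using \<xi>(1,2) by (intro ip_h_stage_linear[symmetric] i'(1) \<phi> Vh_L2[OF U])
    finally show "ip D (?d i) \<phi> =
        - G D (?p i) \<phi> - ip D (\<lambda>x. h i x * rk_stage s A \<tau> (\<lambda>x. 0) (l ?d) i x) \<phi>" .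
  qed
  then have "AE x in lebesgue_on (Omega D). b i = 0 \<or> \<xi> i x = \<xi>' i x" if "i \<in> {1..s}" for i
    using that by (cases "b i = 0") (simp_all add: eq_on_def)
  then have "AE x in lebesgue_on (Omega D). \<forall>i\<in>{1..s}. b i = 0 \<or> \<xi> i x = \<xi>' i x"
    by (intro AE_finite_allI) auto
  then have AE: "AE x in lebesgue_on (Omega D). \<forall>i\<in>{1..s}. b i * \<xi> i x = b i * \<xi>' i x"
    by (rule eventually_mono) auto
  \<comment> \<open>The factor \<open>g\<close> is 1 for the update of u and
    \<open>1 / 2 * H\<close> evaluated at \<open>ustar\<close> for that of U, so one statement
    covers both.\<close>
  have upd: "eq_on D (rk_update s b \<tau> v (\<lambda>i x. g i x * \<xi> i x)) (rk_update s b \<tau> v (\<lambda>i x. g i x * \<xi>' i x))"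
    for v and g :: "nat \<Rightarrow> 'a \<Rightarrow> real"
    unfolding eq_on_def using AE
  proof eventually_elim
    case (elim x)
    have "(\<Sum>i=1..s. b i * (g i x * \<xi> i x)) = (\<Sum>i=1..s. b i * (g i x * \<xi>' i x))"
    proof (intro sum.cong refl)
      fix i assume "i \<in> {1..s}"
      with elim have "b i * \<xi> i x = b i * \<xi>' i x" by blast
      then show "b i * (g i x * \<xi> i x) = b i * (g i x * \<xi>' i x)" by auto
    qed
    then show ?case by (simp add: rk_update_def)
  qed
  have "eq_on D u1 (rk_update s b \<tau> u \<xi>)" using S by blast
  also have "eq_on D (rk_update s b \<tau> u \<xi>) (rk_update s b \<tau> u \<xi>')" using upd[of u "\<lambda>_ _. 1"] by simp
  also have "eq_on D (rk_update s b \<tau> u \<xi>') u1'" using S' by (blast intro: eq_on_sym)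
  finally have u1: "eq_on D u1 u1'" .
  have "eq_on D q1 (Lh D u1)" using S by blast
  also have "eq_on D (Lh D u1) (Lh D u1')" using S S' u1 by (blast intro: Lh_cong)
  also have "eq_on D (Lh D u1') q1'" using S' by (blast intro: eq_on_sym)
  finally have q1: "eq_on D q1 q1'" .
  have "eq_on D (rk_update s b \<tau> U (l \<xi>)) (rk_update s b \<tau> U (l \<xi>'))"
    unfolding stage_l_def[abs_def] by (rule upd)
  then have L: "eq_on D (L2proj D (rk_update s b \<tau> U (l \<xi>))) (L2proj D (rk_update s b \<tau> U (l \<xi>')))"
    using \<xi> by (intro L2proj_cong rk_update_l_L2 Vh_L2[OF U])
  have "eq_on D U1 (L2proj D (rk_update s b \<tau> U (l \<xi>)))" using S by blast
  also note L
  also have "eq_on D (L2proj D (rk_update s b \<tau> U (l \<xi>'))) U1'" using S' by (blast intro: eq_on_sym)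
  finally have "eq_on D U1 U1'" .
  with u1 q1 show ?thesis by blast
qed

text \<open>The estimate is available for the new value of U before projection, and projecting it
  cannot increase the norm.\<close>

lemma leqrk_dg_energy:
  assumes u: "u \<in> Vh D" and U: "U \<in> Vh D" and q0: "q0 \<in> Vh D" "eq_on D q0 (Lh D u)"
    and J: "active \<subseteq> J"
    and sol: "leqrk_dg D \<Phi> C0 s A b \<tau> u U ustar J \<xi> q u1 q1 U1"
  shows "energy D q1 U1 \<le> energy D q0 U - \<tau> * (\<Sum>i=1..s. b i * (l2norm D (\<xi> i))\<^sup>2)"
proof -
  note S = sol[unfolded leqrk_dg_def]
  have \<xi>: "\<xi> i \<in> Vh D" "q i \<in> Vh D" if "i \<in> {1..s}" for i using S that by blast+
  have u1: "rk_update s b \<tau> u \<xi> \<in> Vh D"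
    unfolding rk_update_eq_stage[where i = 0] using \<xi> u by (intro rk_stage_Vh)
  \<comment> \<open>\<open>u1\<close> equals the update, and \<open>q1\<close> equals
    \<open>Lh D u1\<close>, only almost everywhere. This transfers both equalities to the weak
    identity that the estimate requires.\<close>
  have Lh_eq: "ip D p \<psi> = G D w \<psi>"
    if "p \<in> Vh D" "v \<in> Vh D" "w \<in> Vh D" "eq_on D p (Lh D v)" "eq_on D v w" "\<psi> \<in> Vh D" for p v w \<psi>
  proof -
    have "ip D p \<psi> = ip D (Lh D v) \<psi>" using that by (intro ip_cong eq_on_refl Vh_L2 Lh_Vh)
    also have "\<dots> = G D w \<psi>" using that by (simp add: ip_Lh G_cong[of w v])
    finally show ?thesis .
  qed
  let ?W = "rk_update s b \<tau> U (l \<xi>)"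
  have "1 / 2 * ip D q1 q1 + ip D ?W ?W \<le>
      1 / 2 * ip D q0 q0 + ip D U U - \<tau> * (\<Sum>i=1..s. b i * ip D (\<xi> i) (\<xi> i))"
  proof (rule energy_estimate[where u = u and q = q])
    show "ip D q0 \<psi> = G D u \<psi>" if "\<psi> \<in> Vh D" for \<psi>
      using q0 u that by (intro Lh_eq[where v = u] eq_on_refl)
    show "ip D q1 \<psi> = G D (rk_update s b \<tau> u \<xi>) \<psi>" if "\<psi> \<in> Vh D" for \<psi>
      using S u1 that by (intro Lh_eq[where v = u1]) blast+
    show "ip D (\<xi> i) \<phi> = - G D (q i) \<phi> - ip D (\<lambda>x. h i x * rk_stage s A \<tau> U (l \<xi>) i x) \<phi>"
      if "i \<in> active" "\<phi> \<in> Vh D" for i \<phi>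
      using S J that by blast
    show "ip D (q i) \<psi> = G D (rk_stage s A \<tau> u \<xi> i) \<psi>" if "i \<in> {1..s}" "\<psi> \<in> Vh D" for i \<psi>
      using S that by blast
    show "q1 \<in> Vh D" using S by blast
  qed (use u q0 \<xi> Vh_L2[OF U] in auto)
  moreover have "ip D U1 U1 \<le> ip D ?W ?W"
    using S \<xi> by (intro ip_L2proj_le rk_update_l_L2 Vh_L2[OF U]) auto
  ultimately show ?thesis unfolding energy_def l2norm_power2 by linarith
qed

end

theorem theorem3p1:
  fixes D :: "'a::euclidean_space dg_setting"
    and \<sigma> C0 \<tau> :: real
    and \<Phi> :: "real \<Rightarrow> real"
    and s :: nat
    and A :: "nat \<Rightarrow> nat \<Rightarrow> real"
    and b c :: "nat \<Rightarrow> real"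
    and u0 q0 U0 :: "'a \<Rightarrow> real"
    and ustar :: "nat \<Rightarrow> 'a \<Rightarrow> real"
  assumes setting: "valid_setting \<sigma> D"
    and Phi_C1: "\<forall>w. \<Phi> field_differentiable at w" "continuous_on UNIV (deriv \<Phi>)"
    and Phi_bounded_below: "\<exists>m. \<forall>w. m \<le> \<Phi> w"
    and C0: "\<forall>w. 0 < \<Phi> w + C0"
    and stages: "1 \<le> s"
    and nodes: "\<forall>i\<in>{1..s}. c i = (\<Sum>j=1..s. A i j)"
    and weights: "(\<Sum>i=1..s. b i) = 1"
    and stable: "algebraically_stable s A b"
    and data: "u0 \<in> Vh D" "U0 \<in> Vh D" "\<forall>i\<in>{1..s}. ustar i \<in> Vh D"
    and q0: "q0 \<in> Vh D" "eq_on D q0 (Lh D u0)"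
    and step: "0 < \<tau>"
  shows
    "(\<exists>\<xi> q u1 q1 U1.
        leqrk_dg D \<Phi> C0 s A b \<tau> u0 U0 ustar {i\<in>{1..s}. b i \<noteq> 0} \<xi> q u1 q1 U1) \<and>
     (\<forall>J. {i\<in>{1..s}. b i \<noteq> 0} \<subseteq> J \<and> J \<subseteq> {1..s} \<longrightarrow>
        (\<forall>\<xi> q u1 q1 U1 \<xi>' q' u1' q1' U1'.
           leqrk_dg D \<Phi> C0 s A b \<tau> u0 U0 ustar J \<xi> q u1 q1 U1 \<and>
           leqrk_dg D \<Phi> C0 s A b \<tau> u0 U0 ustar J \<xi>' q' u1' q1' U1' \<longrightarrow>
           eq_on D u1 u1' \<and> eq_on D q1 q1' \<and> eq_on D U1 U1') \<and>
        (\<forall>\<xi> q u1 q1 U1.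
           leqrk_dg D \<Phi> C0 s A b \<tau> u0 U0 ustar J \<xi> q u1 q1 U1 \<longrightarrow>
           energy D q1 U1 \<le> energy D q0 U0 - \<tau> * (\<Sum>i=1..s. b i * (l2norm D (\<xi> i))\<^sup>2)))"
proof -
  interpret leqrk_step D \<sigma> \<Phi> C0 \<tau> s A b ustar
    using setting Phi_C1 C0 stable data(3) step by unfold_locales
  show ?thesis
    using leqrk_dg_exists[OF data(1,2)] leqrk_dg_unique[OF data(1,2)]
      leqrk_dg_energy[OF data(1,2) q0]
    by blast
qed

end
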